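(* Let $b>-\frac12$, let $x,y\in\mathbb R\setminus\{0\}$ and let $t\in\mathbb R$ with $|t|\neq||x|-|y||$ and $|t|\ne|x|+|y|$. Put $u=\frac{x^2+y^2-t^2}{2|x||y|}$. Then \[K_{b}(x,y;t)=b\,\mathrm{sgn}(t)\times\begin{cases} 0 & \text{if } |t|<||x|-|y||,\\[4pt] \frac12\bigl\{-P_{b-1}(u)+\mathrm{sgn}(xy)P_{b}(u)\bigr\} & \text{if } ||x|-|y||<|t|<|x|+|y|,\\[4pt] -\frac{\sin(b\pi)}{\pi}\bigl\{Q_{b-1}(-u)+\mathrm{sgn}(xy)Q_{b}(-u)\bigr\} & \text{if } |x|+|y|<|t|. \end{cases}\]
   Context: Legendre function of the second kind: \[Q_{\nu}(w)=\frac12\sum_{m=0}^{\infty}\frac{\Gamma\left(\frac{\nu+1}{2}+m\right)\Gamma\left(\frac{\nu+2}{2}+m\right)}{\Gamma\left(\nu+\frac32+m\right)m!}\,w^{-2m-\nu-1}\qquad(w>1),\] continued analytically to $\mathbb C\setminus(-\infty,1]$. Legendre function of the first kind: \[P_{\nu}(u)=\sum_{m=0}^{\infty}\frac{(-\nu)_{m}(\nu+1)_{m}}{m!\,m!}\left(\frac{1-u}{2}\right)^{m}\qquad(-1<u\le1),\] where $(a)_m=a(a+1)\cdots(a+m-1)$. Put $\Psi_b(w)=b\,w^b\bigl(Q_{b-1}(w)-Q_b(w)\bigr)$, i.e. for $|w|>1$ \[\Psi_b(w)=\frac b2\left(\sum_{m\ge0}\frac{\Gamma(\frac b2+m)\Gamma(\frac{b+1}2+m)}{\Gamma(b+\frac12+m)\,m!}w^{-2m}-\sum_{m\ge0}\frac{\Gamma(\frac{b+1}2+m)\Gamma(\frac{b+2}2+m)}{\Gamma(b+\frac32+m)\,m!}w^{-2m-1}\right),\]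 continued analytically to $\mathbb C\setminus[-1,1]$. For $b=0$ the product $b\,Q_{b-1}$ (equivalently $b\,\Gamma(\frac b2)$) is understood everywhere by its limit $b\to0$, so that $\Psi_0=1$. For nonzero real $x,y$ and $z\in\mathbb C\setminus\mathbb R$, \[\Phi_{b}(x,y;z)= \left(\frac{x^2+y^2-z^2}{2}\right)^{-b}\Psi_{b}\left(\frac{x^2+y^2-z^2}{2xy}\right)\] with the principal branch of the power; equivalently \[|x|^b|y|^b\Phi_b(x,y;z)=b\left\{Q_{b-1}\left(\frac{x^2+y^2-z^2}{2|x||y|}\right)-\mathrm{sgn}(xy)\,Q_b\left(\frac{x^2+y^2-z^2}{2|x||y|}\right)\right\}.\] The kernel is \[K_{b}(x,y;t) = \frac{-1}{2\pi i} |x|^{b}|y|^{b}\lim_{\varepsilon\rightarrow +0}\Bigl(\Phi_{b}(x,y;t+i\varepsilon)-\Phi_{b}(x,y;t-i\varepsilon)\Bigr).\] Convention: $\mathrm{sgn}(0)=0$. *)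

theory Defs
  imports "HOL-Complex_Analysis.Complex_Analysis"
begin

(* The holomorphic function on T that agrees with f on S.  Both uses below have T open and
   connected and S containing a limit point of itself, so by the identity theorem the values
   on T do not depend on the choice (see analytic_ext_eqI); off T the value is never used. *)
definition analytic_ext ::
  "complex set \<Rightarrow> complex set \<Rightarrow> (complex \<Rightarrow> complex) \<Rightarrow> complex \<Rightarrow> complex" where
  "analytic_ext S T f = (SOME g. g holomorphic_on T \<and> (\<forall>w\<in>S. g w = f w))"

lemma analytic_ext_eqI:
  assumes "open T" "connected T" "S \<subseteq> T" "\<xi> \<in> T" "\<xi> islimpt S"
    and g: "g holomorphic_on T" "\<And>w. w \<in> S \<Longrightarrow> g w = f w" and "w \<in> T"
  shows "analytic_ext S T f w = g w"
proof -
  let ?h = "analytic_ext S T f"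
  have h: "?h holomorphic_on T \<and> (\<forall>w\<in>S. ?h w = f w)"
    unfolding analytic_ext_def
    by (rule someI[where x = g]) (use g in auto)
  have "?h w - g w = 0"
  proof (rule analytic_continuation[of "\<lambda>w. ?h w - g w" T S \<xi>])
    show "(\<lambda>w. ?h w - g w) holomorphic_on T"
      using h g by (intro holomorphic_intros) auto
  qed (use assms h in auto)
  then show ?thesis by simp
qed

definition legendre_Q_series :: "real \<Rightarrow> complex \<Rightarrow> complex" where
  "legendre_Q_series \<nu> w = 1/2 * (\<Sum>m. of_real
      (Gamma ((\<nu> + 1) / 2 + real m) * Gamma ((\<nu> + 2) / 2 + real m)
        / (Gamma (\<nu> + 3/2 + real m) * fact m)) * w powr of_real (- 2 * real m - \<nu> - 1))"

definition legendre_Q :: "real \<Rightarrow> complex \<Rightarrow> complex" where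
  "legendre_Q \<nu> =
    analytic_ext (of_real ` {1<..}) (- (of_real ` {..1})) (legendre_Q_series \<nu>)"

(* The series converges for -1 < u \<le> 1, the only range in which it is used. *)
definition legendre_P :: "real \<Rightarrow> real \<Rightarrow> real" where
  "legendre_P \<nu> u = (\<Sum>m. pochhammer (- \<nu>) m * pochhammer (\<nu> + 1) m / (fact m * fact m)
      * ((1 - u) / 2) ^ m)"

(* The product of b with Q_(b-1).  Q_\<nu> has a pole at \<nu> = -1, where Gamma is totalised by
   Gamma 0 = 0, so the product at b = 0 is its limit. *)
definition b_legendre_Q :: "real \<Rightarrow> complex \<Rightarrow> complex" where
  "b_legendre_Q b w =
    (if b = 0 then Lim (at 0) (\<lambda>a. of_real a * legendre_Q (a - 1) w)
     else of_real b * legendre_Q (b - 1) w)"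

(* The same limit convention for the coefficients b * Gamma (b/2 + m) of that product. *)
definition b_Gamma :: "real \<Rightarrow> nat \<Rightarrow> real" where
  "b_Gamma b m =
    (if b = 0 then Lim (at 0) (\<lambda>a. a * Gamma (a / 2 + real m)) else b * Gamma (b / 2 + real m))"

(* For real w > 1 this is b w^b (Q_(b-1)(w) - Q_b(w)). *)
definition Psi_series :: "real \<Rightarrow> complex \<Rightarrow> complex" where
  "Psi_series b w =
     1/2 * (\<Sum>m. of_real (b_Gamma b m * Gamma ((b + 1) / 2 + real m)
                    / (Gamma (b + 1/2 + real m) * fact m)) * (1 / w) ^ (2 * m))
     - of_real b / 2 * (\<Sum>m. of_real (Gamma ((b + 1) / 2 + real m) * Gamma ((b + 2) / 2 + real m)
                    / (Gamma (b + 3/2 + real m) * fact m)) * (1 / w) ^ (2 * m + 1))"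

definition Psi :: "real \<Rightarrow> complex \<Rightarrow> complex" where
  "Psi b = analytic_ext {w. norm w > 1} (- (of_real ` {-1..1})) (Psi_series b)"

(* Only meant for nonzero x, y and non-real z.  Then (x^2 + y^2 - z^2)/2 is off the cut of the
   principal power and the argument of Psi is off [-1,1]. *)
definition Phi :: "real \<Rightarrow> real \<Rightarrow> real \<Rightarrow> complex \<Rightarrow> complex" where
  "Phi b x y z =
    ((of_real x ^ 2 + of_real y ^ 2 - z ^ 2) / 2) powr (- of_real b)
      * Psi b ((of_real x ^ 2 + of_real y ^ 2 - z ^ 2) / (2 * of_real x * of_real y))"

definition Phi_jump :: "real \<Rightarrow> real \<Rightarrow> real \<Rightarrow> real \<Rightarrow> real \<Rightarrow> complex" where
  "Phi_jump b x y t \<epsilon> =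
    Phi b x y (of_real t + \<i> * of_real \<epsilon>) - Phi b x y (of_real t - \<i> * of_real \<epsilon>)"

definition kernel_K :: "real \<Rightarrow> real \<Rightarrow> real \<Rightarrow> real \<Rightarrow> complex" where
  "kernel_K b x y t =
    - 1 / (2 * of_real pi * \<i>) * of_real (\<bar>x\<bar> powr b * \<bar>y\<bar> powr b)
      * Lim (at_right 0) (Phi_jump b x y t)"

end

theory Submission
  imports Defs
begin

text \<open>Let \<open>b \<noteq> 0\<close>, so that the degrees \<open>\<nu> = b - 1\<close> and \<open>\<nu> = b\<close> satisfy \<open>\<nu> > -3/2\<close> and \<open>\<nu> \<noteq> -1\<close>.
Up to the factor \<open>\<bar>x\<bar>\<^sup>b\<bar>y\<bar>\<^sup>b\<close>, the function \<open>Phi b x y\<close> is \<open>b (Q\<^bsub>b-1\<^esub> - sgn(xy) Q\<^sub>b)\<close> evaluated at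
\<open>w = (x\<^sup>2 + y\<^sup>2 - z\<^sup>2) / (2\<bar>x\<bar>\<bar>y\<bar>)\<close>. As \<open>z\<close> tends to the real point \<open>t\<close> from above or from below, \<open>w\<close> tends
to \<open>u\<close> from opposite sides of the real axis, and the sign of \<open>t\<close> decides which side belongs to
which. So \<open>kernel_K\<close> is, up to constants, the jump of \<open>Q\<^bsub>b-1\<^esub>\<close> and \<open>Q\<^sub>b\<close> across the real axis at \<open>u\<close>,
and the three cases of the formula are \<open>u > 1\<close>, \<open>-1 < u < 1\<close> and \<open>u < -1\<close>.

For \<open>\<bar>w\<bar> > 1\<close> one has \<open>Q\<^sub>\<nu>(w) = w\<^bsup>-\<nu>-1\<^esup> E(w\<^bsup>-2\<^esup>)\<close> with a power series \<open>E\<close>. The heart of the proof is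
the connection formula \<open>legendre_Q_connection\<close>: on the crescent \<open>\<bar>w\<bar> > 1\<close>, \<open>\<bar>w - 1\<bar> < 2\<close>,

  \<open>Q\<^sub>\<nu>(w) = - (1/2) P\<^sub>\<nu>(w) Ln(w - 1) + R(w)\<close> with \<open>R\<close> holomorphic on the whole disc \<open>\<bar>w - 1\<bar> < 2\<close>.

Both \<open>Q\<^sub>\<nu>\<close> and the logarithmic Frobenius solution at \<open>w = 1\<close> solve the Legendre equation. Their
combination \<open>D = Q\<^sub>\<nu> + (1/2)(P\<^sub>\<nu> Ln(w - 1) + \<dots>)\<close> has a Wronskian with \<open>P\<^sub>\<nu>\<close> which, multiplied by
\<open>1 - w\<^sup>2\<close>, is constant; the constant is \<open>0\<close>, as one sees by letting \<open>w\<close> decrease to \<open>1\<close>. The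
behaviour of \<open>Q\<^sub>\<nu>\<close> there comes from the coefficients of \<open>E\<close>, which are asymptotic to \<open>1/(2m)\<close>,
through an Abelian limit theorem. Hence \<open>D\<close> is a multiple of \<open>P\<^sub>\<nu>\<close> near \<open>1\<close>, and by analytic
continuation on the crescent, which is connected because \<open>1/(w + 1)\<close> maps it onto a strip.

The disc \<open>\<bar>w - 1\<bar> < 2\<close> contains every point of the closed unit disc except \<open>-1\<close>. So the connection
formula extends \<open>G(w) = w\<^bsup>\<nu>+1\<^esup> Q\<^sub>\<nu>(w)\<close> holomorphically to the complement of \<open>[-1, 1]\<close>, as an even
function. This gives the continuations of \<open>Q\<^sub>\<nu>\<close> and of \<open>Psi\<close>, and the jumps can be read off
(\<open>legendre_Q_jump\<close>): none for \<open>u > 1\<close>; that of the logarithm for \<open>-1 < u < 1\<close>, which produces \<open>P\<^sub>\<nu>\<close>;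
and for \<open>u < -1\<close> that of \<open>w\<^bsup>-\<nu>-1\<^esup>\<close>, where \<open>G\<close> is continuous and even, which produces the sine and
the argument \<open>-u\<close>. For \<open>b = 0\<close> the function \<open>Psi\<close> is constant \<open>1\<close>, and both sides vanish.\<close>

section \<open>Power series on the unit disc and the hypergeometric equation\<close>

lemma fps_conv_radius_ge_1_of_linear_bound:
  fixes f :: "complex fps"
  assumes "\<And>n. norm (fps_nth f n) \<le> C * (real n + 1)"
  shows "1 \<le> fps_conv_radius f"
  unfolding fps_conv_radius_def
proof (rule conv_radius_geI_ex')
  fix r :: real assume r: "0 < r" "ereal r < 1"
  have "summable (\<lambda>n. C * (of_nat (Suc n) * r ^ n))"
    using r by (intro summable_mult sums_summable[OF geometric_deriv_sums]) auto
  then show "summable (\<lambda>n. fps_nth f n * of_real r ^ n)"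
  proof (rule summable_comparison_test'[where N = 0])
    fix n
    have "norm (fps_nth f n) * r ^ n \<le> C * (real n + 1) * r ^ n"
      using assms[of n] r by (intro mult_right_mono) auto
    then show "norm (fps_nth f n * of_real r ^ n) \<le> C * (of_nat (Suc n) * r ^ n)"
      using r by (simp add: norm_mult norm_power algebra_simps)
  qed
qed

text \<open>For the recursion of the Frobenius coefficients, whose homogeneous part eventually does
not increase absolute values while the inhomogeneous part is only bounded.\<close>
lemma linear_bound_of_increments:
  fixes a :: "nat \<Rightarrow> real"
  assumes nonneg: "\<And>n. 0 \<le> a n" and step: "\<And>n. n \<ge> N \<Longrightarrow> a (Suc n) \<le> a n + B"
  shows "\<exists>C. \<forall>n. a n \<le> C * (real n + 1)"
proof -
  define C where "C = (\<Sum>k\<le>N. a k) + \<bar>B\<bar>"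
  have base: "a n \<le> C" if "n \<le> N" for n
    using member_le_sum[of n "{..N}" a] that nonneg by (simp add: C_def)
  have C: "0 \<le> C" "\<bar>B\<bar> \<le> C"
    using nonneg by (auto simp: C_def sum_nonneg)
  have "a n \<le> C * (real n + 1)" for n
  proof (induction n)
    case 0
    then show ?case using base[of 0] by simp
  next
    case (Suc n)
    show ?case
    proof (cases "n \<ge> N")
      case True
      then have "a (Suc n) \<le> C * (real n + 1) + C"
        using step[OF True] Suc.IH C by linarith
      then show ?thesis by (simp add: algebra_simps)
    next
      case False
      then have "a (Suc n) \<le> C * 1" using base[of "Suc n"] by simp
      also have "\<dots> \<le> C * (real (Suc n) + 1)"
        using C by (intro mult_left_mono) auto
      finally show ?thesis .
    qed
  qed
  then show ?thesis by blast
qed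

lemma fps_conv_radius_ge_1_intros:
  fixes f g :: "complex fps"
  assumes "1 \<le> fps_conv_radius f"
  shows "1 \<le> fps_conv_radius g \<Longrightarrow> 1 \<le> fps_conv_radius (f + g)"
    and "1 \<le> fps_conv_radius g \<Longrightarrow> 1 \<le> fps_conv_radius (f - g)"
    and "1 \<le> fps_conv_radius g \<Longrightarrow> 1 \<le> fps_conv_radius (f * g)"
    and "1 \<le> fps_conv_radius (fps_deriv f)"
  using assms fps_conv_radius_add[of f g] fps_conv_radius_diff[of f g]
    fps_conv_radius_mult[of f g] fps_conv_radius_deriv[of f]
  by (meson min.boundedI order_trans)+

lemma in_disc_of_radius_ge_1:
  fixes f :: "complex fps"
  assumes "1 \<le> fps_conv_radius f" "norm z < 1"
  shows "norm z < fps_conv_radius f" "norm z < fps_conv_radius (fps_deriv f)"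
    "norm z < fps_conv_radius (fps_deriv (fps_deriv f))"
proof -
  have 1: "ereal (norm z) < fps_conv_radius f"
    using assms by (meson ereal_less(3) order_less_le_trans)
  have 2: "ereal (norm z) < fps_conv_radius (fps_deriv f)"
    using 1 fps_conv_radius_deriv[of f] by (rule order_less_le_trans)
  have 3: "ereal (norm z) < fps_conv_radius (fps_deriv (fps_deriv f))"
    using 2 fps_conv_radius_deriv[of "fps_deriv f"] by (rule order_less_le_trans)
  show "norm z < fps_conv_radius f" "norm z < fps_conv_radius (fps_deriv f)"
    "norm z < fps_conv_radius (fps_deriv (fps_deriv f))"
    using 1 2 3 by auto
qed

text \<open>The operator \<open>X(1 - X) f'' + (c - d X) f' + e f\<close>. With \<open>c = 1\<close>, \<open>d = 2\<close> it is the Legendre operator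
in the variable \<open>(1 - w)/2\<close>; other parameters give the equation of \<open>Q\<^sub>\<nu>\<close> in the variable \<open>w\<^bsup>-2\<^esup>\<close>.
Working with formal series turns each differential equation into a recursion of coefficients.\<close>
definition hypergeometric_op :: "complex \<Rightarrow> complex \<Rightarrow> complex \<Rightarrow> complex fps \<Rightarrow> complex fps" where
  "hypergeometric_op c d e f =
     fps_X * (1 - fps_X) * fps_deriv (fps_deriv f)
     + (fps_const c - fps_const d * fps_X) * fps_deriv f + fps_const e * f"

lemma fps_nth_hypergeometric_op:
  "fps_nth (hypergeometric_op c d e f) n =
     of_nat (n + 1) * (of_nat n + c) * fps_nth f (n + 1)
     - (of_nat n * (of_nat n - 1) + d * of_nat n - e) * fps_nth f n"
proof -
  have "hypergeometric_op c d e f =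
     fps_X * fps_deriv (fps_deriv f) - fps_X * (fps_X * fps_deriv (fps_deriv f))
     + fps_const c * fps_deriv f - fps_const d * (fps_X * fps_deriv f) + fps_const e * f"
    by (simp add: hypergeometric_op_def algebra_simps)
  also have "fps_nth \<dots> n = of_nat (n + 1) * (of_nat n + c) * fps_nth f (n + 1)
     - (of_nat n * (of_nat n - 1) + d * of_nat n - e) * fps_nth f n"
  proof (cases n)
    case 0
    then show ?thesis by simp
  next
    case (Suc k)
    then show ?thesis by (cases k) (simp_all add: algebra_simps)
  qed
  finally show ?thesis .
qed

lemma eval_hypergeometric_op:
  assumes rad: "1 \<le> fps_conv_radius f" and z: "norm z < 1"
  shows "eval_fps (hypergeometric_op c d e f) z =
    z * (1 - z) * eval_fps (fps_deriv (fps_deriv f)) z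
    + (c - d * z) * eval_fps (fps_deriv f) z + e * eval_fps f z"
proof -
  note in_disc = in_disc_of_radius_ge_1(1)[OF _ z]
  show ?thesis
    unfolding hypergeometric_op_def
    by (simp add: eval_fps_add eval_fps_diff eval_fps_mult in_disc fps_conv_radius_ge_1_intros rad)
qed

text \<open>Since \<open>(1 - x) (\<Sum>x\<^sup>n) = 1\<close>, the quantity is a weighted mean of the coefficients, and as \<open>x\<close> tends to
\<open>1\<close> every finite set of coefficients loses its weight.\<close>
lemma abelian_limit:
  fixes f :: "complex fps"
  assumes lim: "fps_nth f \<longlonglongrightarrow> a" and rad: "1 \<le> fps_conv_radius f"
  shows "((\<lambda>x::real. (1 - of_real x) * eval_fps f (of_real x)) \<longlongrightarrow> a) (at_left 1)"
proof (rule tendstoI)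
  fix \<epsilon> :: real assume \<epsilon>: "\<epsilon> > 0"
  then obtain N where N: "\<And>n. n \<ge> N \<Longrightarrow> norm (fps_nth f n - a) < \<epsilon> / 2"
    using LIMSEQ_D[OF lim, of "\<epsilon> / 2"] by auto
  define M where "M = (\<Sum>n<N. norm (fps_nth f n - a))"
  have bound: "norm ((1 - of_real x) * eval_fps f (of_real x) - a) \<le> (1 - x) * M + \<epsilon> / 2"
    if x: "0 < x" "x < 1" for x :: real
  proof -
    define g where "g n = (fps_nth f n - a) * of_real x ^ n" for n
    define h where "h n = (if n < N then norm (fps_nth f n - a) else 0) + \<epsilon> / 2 * x ^ n" for n
    have rx: "ereal (norm (of_real x :: complex)) < fps_conv_radius f"
      using x rad by (simp add: order_less_le_trans[OF _ rad])
    have f_sums: "(\<lambda>n. fps_nth f n * of_real x ^ n) sums eval_fps f (of_real x)"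
      by (rule sums_eval_fps[OF rx])
    have "(\<lambda>n. (of_real x :: complex) ^ n) sums (1 / (1 - of_real x))"
      using x by (intro geometric_sums) simp
    from sums_diff[OF f_sums sums_mult[OF this, of a]]
    have g_sums: "g sums (eval_fps f (of_real x) - a * (1 / (1 - of_real x)))"
      unfolding g_def by (simp only: left_diff_distrib)
    have h_sums: "h sums (M + \<epsilon> / 2 * (1 / (1 - x)))"
    proof -
      have "(\<lambda>n. if n < N then norm (fps_nth f n - a) else 0) sums M"
        using sums_If_finite_set[of "{..<N}" "\<lambda>n. norm (fps_nth f n - a)"] by (simp add: M_def)
      then show ?thesis
        unfolding h_def using x by (intro sums_add sums_mult geometric_sums) auto
    qed
    have gh: "norm (g n) \<le> h n" for n
    proof (cases "n < N")
      case True
      have "norm (fps_nth f n - a) * x ^ n \<le> norm (fps_nth f n - a) * 1"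
        using x by (intro mult_left_mono power_le_one) auto
      moreover have "0 \<le> \<epsilon> / 2 * x ^ n" using \<epsilon> x by simp
      ultimately show ?thesis using True x by (simp add: g_def h_def norm_mult norm_power)
    next
      case False
      then have "norm (fps_nth f n - a) * x ^ n \<le> \<epsilon> / 2 * x ^ n"
        using N[of n] x by (intro mult_right_mono) auto
      then show ?thesis using False x by (simp add: g_def h_def norm_mult norm_power)
    qed
    have "norm (suminf g) \<le> suminf h"
      by (rule norm_suminf_le[OF gh sums_summable[OF h_sums]])
    then have le: "norm (eval_fps f (of_real x) - a * (1 / (1 - of_real x))) \<le> M + \<epsilon> / 2 * (1 / (1 - x))"
      using g_sums h_sums by (simp add: sums_unique[symmetric])
    have "(1 - of_real x) * eval_fps f (of_real x) - a
        = of_real (1 - x) * (eval_fps f (of_real x) - a * (1 / (1 - of_real x)))"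
    proof -
      have "(1 - of_real x :: complex) \<noteq> 0" using x by (simp add: complex_eq_iff)
      then show ?thesis by (simp add: right_diff_distrib)
    qed
    then have "norm ((1 - of_real x) * eval_fps f (of_real x) - a)
        = (1 - x) * norm (eval_fps f (of_real x) - a * (1 / (1 - of_real x)))"
      using x by (simp only: norm_mult norm_of_real)
    also have "\<dots> \<le> (1 - x) * (M + \<epsilon> / 2 * (1 / (1 - x)))"
      using le x by (intro mult_left_mono) auto
    also have "\<dots> = (1 - x) * M + \<epsilon> / 2"
    proof -
      have "1 - x \<noteq> 0" using x by simp
      moreover have "d * (M + e * (1 / d)) = d * M + e" if "d \<noteq> 0" for d e :: real
        using that by (simp add: distrib_left)
      ultimately show ?thesis by blast
    qed
    finally show ?thesis .
  qed
  have "((\<lambda>x::real. (1 - x) * M + \<epsilon> / 2) \<longlongrightarrow> (1 - 1) * M + \<epsilon> / 2) (at_left 1)"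
    by (intro tendsto_intros)
  then have "\<forall>\<^sub>F x in at_left (1::real). (1 - x) * M + \<epsilon> / 2 < \<epsilon>"
    using \<epsilon> by (elim order_tendstoD(2)) simp
  moreover have "\<forall>\<^sub>F x in at_left (1::real). 0 < x"
    by (rule order_tendstoD(1)[OF tendsto_ident_at]) simp
  moreover have "\<forall>\<^sub>F x in at_left (1::real). x < 1"
    by (simp add: eventually_at_filter)
  ultimately show "\<forall>\<^sub>F x in at_left (1::real). dist ((1 - of_real x) * eval_fps f (of_real x)) a < \<epsilon>"
  proof eventually_elim
    case (elim x)
    then show ?case using bound[of x] by (simp add: dist_norm)
  qed
qed

section \<open>The three coefficient sequences\<close>

definition legendre_P_coeff :: "real \<Rightarrow> nat \<Rightarrow> real" where
  "legendre_P_coeff \<nu> m = pochhammer (- \<nu>) m * pochhammer (\<nu> + 1) m / (fact m * fact m)"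

definition legendre_P_fps :: "real \<Rightarrow> complex fps" where
  "legendre_P_fps \<nu> = Abs_fps (\<lambda>m. of_real (legendre_P_coeff \<nu> m))"

text \<open>With \<open>s = (1 - w)/2\<close>, the recursion says that \<open>P\<^sub>\<nu>(w) Ln(w - 1) + \<Sum>\<^sub>m r\<^sub>m s\<^sup>m\<close> solves the Legendre
equation. The free term \<open>r\<^sub>0\<close> only adds a multiple of \<open>P\<^sub>\<nu>\<close> and is set to \<open>0\<close>.\<close>
fun frobenius_coeff :: "real \<Rightarrow> nat \<Rightarrow> real" where
  "frobenius_coeff \<nu> 0 = 0"
| "frobenius_coeff \<nu> (Suc m) =
    ((real m * (real m + 1) - \<nu> * (\<nu> + 1)) * frobenius_coeff \<nu> m
      + (2 * real m + 1) * legendre_P_coeff \<nu> m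
      - 2 * (real m + 1) * legendre_P_coeff \<nu> (Suc m)) / (real m + 1)\<^sup>2"

definition frobenius_fps :: "real \<Rightarrow> complex fps" where
  "frobenius_fps \<nu> = Abs_fps (\<lambda>m. of_real (frobenius_coeff \<nu> m))"

definition legendre_Q_coeff :: "real \<Rightarrow> nat \<Rightarrow> real" where
  "legendre_Q_coeff \<nu> m = 1/2 * (Gamma ((\<nu> + 1) / 2 + real m) * Gamma ((\<nu> + 2) / 2 + real m)
        / (Gamma (\<nu> + 3/2 + real m) * fact m))"

definition legendre_Q_fps :: "real \<Rightarrow> complex fps" where
  "legendre_Q_fps \<nu> = Abs_fps (\<lambda>m. of_real (legendre_Q_coeff \<nu> m))"

lemma legendre_P_coeff_Suc:
  "legendre_P_coeff \<nu> (Suc m) =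
    (real m * (real m + 1) - \<nu> * (\<nu> + 1)) / (real m + 1)\<^sup>2 * legendre_P_coeff \<nu> m"
proof -
  have "(- \<nu> + real m) * (\<nu> + 1 + real m) = real m * (real m + 1) - \<nu> * (\<nu> + 1)"
    by (simp add: algebra_simps)
  moreover have "A * \<alpha> * (B * \<beta>) / (k * F * (k * F)) = \<alpha> * \<beta> / k\<^sup>2 * (A * B / (F * F))"
    for A B \<alpha> \<beta> k F :: real
    by (simp add: power2_eq_square mult_ac)
  moreover have "(fact (Suc m) :: real) = (real m + 1) * fact m"
    by (simp add: add.commute)
  ultimately show ?thesis
    unfolding legendre_P_coeff_def pochhammer_Suc by metis
qed

text \<open>The numerator is at most \<open>(m + 1)\<^sup>2\<close> because \<open>\<nu>(\<nu> + 1) \<ge> -1/4\<close>, and it is nonnegative for large \<open>m\<close>.\<close>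
lemma recursion_factor_bound:
  fixes \<nu> :: real
  obtains N where "\<And>m. m \<ge> N \<Longrightarrow> \<bar>(real m * (real m + 1) - \<nu> * (\<nu> + 1)) / (real m + 1)\<^sup>2\<bar> \<le> 1"
proof
  fix m assume m: "m \<ge> nat \<lceil>\<nu> * (\<nu> + 1)\<rceil>"
  have "0 \<le> (2 * \<nu> + 1)\<^sup>2" by simp
  then have "- 1/4 \<le> \<nu> * (\<nu> + 1)" by (simp add: power2_eq_square algebra_simps)
  moreover have "\<nu> * (\<nu> + 1) \<le> real m" using m by linarith
  moreover have "(real m + 1)\<^sup>2 = real m * (real m + 1) + real m + 1"
    by (simp only: power2_eq_square distrib_right distrib_left mult_1_right mult_1_left add.assoc)
  moreover have "real m \<le> real m * (real m + 1)"
    using mult_left_mono[of 1 "real m + 1" "real m"] by simp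
  moreover have "\<bar>p - c\<bar> \<le> d" if "- 1/4 \<le> c" "c \<le> r" "d = p + r + 1" "r \<le> p" "0 \<le> r" for p c d r :: real
    using that by (simp add: abs_le_iff)
  ultimately have "\<bar>real m * (real m + 1) - \<nu> * (\<nu> + 1)\<bar> \<le> (real m + 1)\<^sup>2"
    by simp
  then show "\<bar>(real m * (real m + 1) - \<nu> * (\<nu> + 1)) / (real m + 1)\<^sup>2\<bar> \<le> 1"
    by (simp add: abs_divide)
qed

lemma legendre_P_coeff_bounded:
  obtains B where "0 \<le> B" "\<And>m. \<bar>legendre_P_coeff \<nu> m\<bar> \<le> B"
proof -
  obtain N where N: "\<And>m. m \<ge> N \<Longrightarrow>
      \<bar>(real m * (real m + 1) - \<nu> * (\<nu> + 1)) / (real m + 1)\<^sup>2\<bar> \<le> 1"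
    using recursion_factor_bound[of \<nu>] by blast
  define B where "B = (\<Sum>k\<le>N. \<bar>legendre_P_coeff \<nu> k\<bar>)"
  have small: "\<bar>legendre_P_coeff \<nu> m\<bar> \<le> B" if "m \<le> N" for m
    using that member_le_sum[of m "{..N}" "\<lambda>k. \<bar>legendre_P_coeff \<nu> k\<bar>"] by (simp add: B_def)
  have "\<bar>legendre_P_coeff \<nu> m\<bar> \<le> B" for m
  proof (induction m)
    case (Suc m)
    show ?case
    proof (cases "m \<ge> N")
      case True
      have "\<bar>legendre_P_coeff \<nu> (Suc m)\<bar> =
          \<bar>(real m * (real m + 1) - \<nu> * (\<nu> + 1)) / (real m + 1)\<^sup>2\<bar> * \<bar>legendre_P_coeff \<nu> m\<bar>"
        by (simp only: legendre_P_coeff_Suc abs_mult)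
      also have "\<dots> \<le> 1 * \<bar>legendre_P_coeff \<nu> m\<bar>"
        using N[OF True] by (intro mult_right_mono) auto
      finally show ?thesis using Suc.IH by simp
    qed (use small[of "Suc m"] in auto)
  qed (use small[of 0] in auto)
  moreover have "0 \<le> B" by (simp add: B_def sum_nonneg)
  ultimately show thesis using that by blast
qed

lemma legendre_P_fps_radius: "1 \<le> fps_conv_radius (legendre_P_fps \<nu>)"
proof -
  obtain B where B: "0 \<le> B" "\<And>m. \<bar>legendre_P_coeff \<nu> m\<bar> \<le> B"
    using legendre_P_coeff_bounded by blast
  show ?thesis
  proof (rule fps_conv_radius_ge_1_of_linear_bound[where C = B])
    fix n
    have "B * 1 \<le> B * (real n + 1)" using B(1) by (intro mult_left_mono) auto
    then show "norm (fps_nth (legendre_P_fps \<nu>) n) \<le> B * (real n + 1)"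
      using B(2)[of n] by (simp add: legendre_P_fps_def)
  qed
qed

lemma frobenius_fps_radius: "1 \<le> fps_conv_radius (frobenius_fps \<nu>)"
proof -
  obtain B where B: "0 \<le> B" "\<And>m. \<bar>legendre_P_coeff \<nu> m\<bar> \<le> B"
    using legendre_P_coeff_bounded by blast
  obtain N where N: "\<And>m. m \<ge> N \<Longrightarrow>
      \<bar>(real m * (real m + 1) - \<nu> * (\<nu> + 1)) / (real m + 1)\<^sup>2\<bar> \<le> 1"
    using recursion_factor_bound[of \<nu>] by blast
  have "\<bar>frobenius_coeff \<nu> (Suc m)\<bar> \<le> \<bar>frobenius_coeff \<nu> m\<bar> + 4 * B" if "m \<ge> N" for m
  proof -
    let ?\<alpha> = "(real m * (real m + 1) - \<nu> * (\<nu> + 1)) / (real m + 1)\<^sup>2"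
    let ?\<beta> = "(2 * real m + 1) / (real m + 1)\<^sup>2" and ?\<gamma> = "2 * (real m + 1) / (real m + 1)\<^sup>2"
    have bg: "\<bar>?\<beta>\<bar> \<le> 2" "\<bar>?\<gamma>\<bar> \<le> 2"
    proof -
      have "0 < y \<Longrightarrow> y \<le> y\<^sup>2 \<Longrightarrow> \<bar>(2 * y - 1) / y\<^sup>2\<bar> \<le> 2 \<and> \<bar>2 * y / y\<^sup>2\<bar> \<le> 2"
        if "1 \<le> y" for y :: real
        using that by (simp add: abs_divide pos_divide_le_eq)
      from this[of "real m + 1"] self_le_power[of "real m + 1" 2]
      have "\<bar>(2 * (real m + 1) - 1) / (real m + 1)\<^sup>2\<bar> \<le> 2" and "\<bar>?\<gamma>\<bar> \<le> 2" by simp_all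
      moreover have "2 * (real m + 1) - 1 = 2 * real m + 1" by simp
      ultimately show "\<bar>?\<beta>\<bar> \<le> 2" "\<bar>?\<gamma>\<bar> \<le> 2" by metis+
    qed
    have "frobenius_coeff \<nu> (Suc m) = ?\<alpha> * frobenius_coeff \<nu> m
        + (?\<beta> * legendre_P_coeff \<nu> m - ?\<gamma> * legendre_P_coeff \<nu> (Suc m))"
    proof -
      have "(A * r + B * p - C * q) / d = A / d * r + (B / d * p - C / d * q)"
        for A B C d r p q :: real
        by (simp add: add_divide_distrib diff_divide_distrib)
      then show ?thesis by (simp only: frobenius_coeff.simps)
    qed
    also have "\<bar>\<dots>\<bar> \<le> \<bar>?\<alpha>\<bar> * \<bar>frobenius_coeff \<nu> m\<bar>
        + (\<bar>?\<beta>\<bar> * \<bar>legendre_P_coeff \<nu> m\<bar> + \<bar>?\<gamma>\<bar> * \<bar>legendre_P_coeff \<nu> (Suc m)\<bar>)"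
      unfolding abs_mult[symmetric]
      by (meson abs_triangle_ineq abs_triangle_ineq4 add_left_mono order_trans)
    also have "\<dots> \<le> 1 * \<bar>frobenius_coeff \<nu> m\<bar> + (2 * B + 2 * B)"
      using N[OF that] bg B by (intro add_mono mult_mono) auto
    finally show ?thesis by simp
  qed
  then obtain C where "\<And>n. \<bar>frobenius_coeff \<nu> n\<bar> \<le> C * (real n + 1)"
    using linear_bound_of_increments[of "\<lambda>n. \<bar>frobenius_coeff \<nu> n\<bar>" N "4 * B"] abs_ge_zero
    by blast
  then show ?thesis
    by (intro fps_conv_radius_ge_1_of_linear_bound[where C = C]) (simp add: frobenius_fps_def)
qed

lemma legendre_P_fps_equation:
  "hypergeometric_op 1 2 (of_real (\<nu> * (\<nu> + 1))) (legendre_P_fps \<nu>) = 0"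
proof (rule fps_ext)
  fix n
  have eq: "(real n + 1)\<^sup>2 * legendre_P_coeff \<nu> (Suc n)
      = (real n * (real n + 1) - \<nu> * (\<nu> + 1)) * legendre_P_coeff \<nu> n"
    by (simp add: legendre_P_coeff_Suc field_simps)
  have "fps_nth (hypergeometric_op 1 2 (of_real (\<nu> * (\<nu> + 1))) (legendre_P_fps \<nu>)) n
      = of_real ((real n + 1)\<^sup>2 * legendre_P_coeff \<nu> (Suc n)
        - (real n * (real n + 1) - \<nu> * (\<nu> + 1)) * legendre_P_coeff \<nu> n)"
    by (simp add: fps_nth_hypergeometric_op legendre_P_fps_def power2_eq_square algebra_simps)
  also have "\<dots> = 0" using eq by simp
  finally show "fps_nth (hypergeometric_op 1 2 (of_real (\<nu> * (\<nu> + 1))) (legendre_P_fps \<nu>)) n = fps_nth 0 n"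
    by simp
qed

text \<open>The right-hand side is what remains, up to sign, when the Legendre operator in \<open>s = (1 - w)/2\<close> is
applied to \<open>P\<^sub>\<nu>(w) Ln(w - 1)\<close>.\<close>
lemma frobenius_fps_equation:
  "hypergeometric_op 1 2 (of_real (\<nu> * (\<nu> + 1))) (frobenius_fps \<nu>)
    = legendre_P_fps \<nu> - 2 * (1 - fps_X) * fps_deriv (legendre_P_fps \<nu>)"
proof (rule fps_ext)
  fix n
  have eq: "(real n + 1)\<^sup>2 * frobenius_coeff \<nu> (Suc n)
      = (real n * (real n + 1) - \<nu> * (\<nu> + 1)) * frobenius_coeff \<nu> n
      + (2 * real n + 1) * legendre_P_coeff \<nu> n - 2 * (real n + 1) * legendre_P_coeff \<nu> (Suc n)"
    by (simp add: field_simps)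
  have rhs: "legendre_P_fps \<nu> - 2 * (1 - fps_X) * fps_deriv (legendre_P_fps \<nu>)
    = legendre_P_fps \<nu> - fps_const 2 * fps_deriv (legendre_P_fps \<nu>)
      + fps_const 2 * (fps_X * fps_deriv (legendre_P_fps \<nu>))"
    by (simp add: algebra_simps numeral_fps_const)
  have "fps_nth (hypergeometric_op 1 2 (of_real (\<nu> * (\<nu> + 1))) (frobenius_fps \<nu>)) n
      = of_real ((real n + 1)\<^sup>2 * frobenius_coeff \<nu> (Suc n)
        - (real n * (real n + 1) - \<nu> * (\<nu> + 1)) * frobenius_coeff \<nu> n)"
    by (simp add: fps_nth_hypergeometric_op frobenius_fps_def power2_eq_square algebra_simps
        del: frobenius_coeff.simps)
  also have "\<dots> = of_real ((2 * real n + 1) * legendre_P_coeff \<nu> n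
      - 2 * (real n + 1) * legendre_P_coeff \<nu> (Suc n))"
    unfolding eq by simp
  also have "\<dots> = fps_nth (legendre_P_fps \<nu> - 2 * (1 - fps_X) * fps_deriv (legendre_P_fps \<nu>)) n"
    unfolding rhs by (cases n) (simp_all add: legendre_P_fps_def algebra_simps)
  finally show "fps_nth (hypergeometric_op 1 2 (of_real (\<nu> * (\<nu> + 1))) (frobenius_fps \<nu>)) n =
      fps_nth (legendre_P_fps \<nu> - 2 * (1 - fps_X) * fps_deriv (legendre_P_fps \<nu>)) n" .
qed

lemma not_nonpos_Int_real_plus_nat:
  fixes x :: real
  assumes "x > -1" "x \<noteq> 0"
  shows "x + real m \<notin> \<int>\<^sub>\<le>\<^sub>0"
proof
  assume "x + real m \<in> \<int>\<^sub>\<le>\<^sub>0"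
  then obtain k where k: "x + real m = - real k" by (elim nonpos_Ints_cases')
  with assms have "real (m + k) < 1" by simp
  then have "m = 0" "k = 0" by auto
  with k assms show False by simp
qed

lemma legendre_Q_coeff_Suc:
  assumes "\<nu> > - 3/2" "\<nu> \<noteq> -1"
  shows "(\<nu> + 3/2 + real m) * (real m + 1) * legendre_Q_coeff \<nu> (Suc m)
    = ((\<nu> + 1) / 2 + real m) * ((\<nu> + 2) / 2 + real m) * legendre_Q_coeff \<nu> m"
proof -
  let ?a = "(\<nu> + 1) / 2" and ?b = "(\<nu> + 2) / 2" and ?c = "\<nu> + 3/2"
  have n: "?a + real m \<notin> \<int>\<^sub>\<le>\<^sub>0" "?b + real m \<notin> \<int>\<^sub>\<le>\<^sub>0" "?c + real m \<notin> \<int>\<^sub>\<le>\<^sub>0"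
    using assms by (intro not_nonpos_Int_real_plus_nat; simp add: field_simps)+
  have S: "Gamma (x + real (Suc m)) = (x + real m) * Gamma (x + real m)"
    if "x + real m \<notin> \<int>\<^sub>\<le>\<^sub>0" for x :: real
    using Gamma_plus1[OF that] by (simp add: algebra_simps)
  have c: "?c + real m \<noteq> 0"
    using n(3) by auto
  have cancel: "\<gamma> * k * (1/2 * (\<alpha> * A * (\<beta> * B) / (\<gamma> * C * (k * F)))) = \<alpha> * \<beta> * (1/2 * (A * B / (C * F)))"
    if "\<gamma> \<noteq> 0" "k \<noteq> 0" for \<alpha> \<beta> \<gamma> k A B C F :: real
    using that by simp
  have k: "real m + 1 \<noteq> 0" "(fact (Suc m) :: real) = (real m + 1) * fact m"
    by (simp_all add: add.commute)
  show ?thesis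
    unfolding legendre_Q_coeff_def S[OF n(1)] S[OF n(2)] S[OF n(3)] k(2)
    by (rule cancel[OF c k(1)])
qed

lemma Gamma_shift_asymp:
  fixes x :: real
  assumes "x \<notin> \<int>\<^sub>\<le>\<^sub>0"
  shows "(\<lambda>n. Gamma (x + real (Suc n)) / (fact n * exp (x * ln (real n)))) \<longlonglongrightarrow> 1"
proof -
  have G: "Gamma x \<noteq> 0" using assms by (simp add: Gamma_eq_zero_iff)
  have "Gamma (x + real (Suc n)) / (fact n * exp (x * ln (real n))) = Gamma x / Gamma_series x n" for n
    using pochhammer_Gamma[OF assms, of "Suc n"] G by (simp add: Gamma_series_def field_simps)
  moreover have "(\<lambda>n. Gamma x / Gamma_series x n) \<longlonglongrightarrow> Gamma x / Gamma x"
    using G by (intro tendsto_intros Gamma_series_LIMSEQ)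
  ultimately show ?thesis using G by simp
qed

text \<open>By the limit formula of Gauss, \<open>\<Gamma>(x + m + 1)\<close> behaves like \<open>m! m\<^sup>x\<close>. The two parameters in the
numerator add up to the one in the denominator, so all powers of \<open>m\<close> cancel. This borderline case
is what makes the singularity at \<open>w = 1\<close> logarithmic, and the limit \<open>1/2\<close> is, up to sign, the factor
in front of the logarithm.\<close>
lemma legendre_Q_coeff_asymp:
  assumes "\<nu> > - 3/2" "\<nu> \<noteq> -1"
  shows "(\<lambda>m. real (Suc m) * legendre_Q_coeff \<nu> (Suc m)) \<longlonglongrightarrow> 1/2"
proof -
  let ?a = "(\<nu> + 1) / 2" and ?b = "(\<nu> + 2) / 2" and ?c = "\<nu> + 3/2"
  let ?g = "\<lambda>x n. Gamma (x + real (Suc n)) / (fact n * exp (x * ln (real n))) :: real"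
  have n: "?a \<notin> \<int>\<^sub>\<le>\<^sub>0" "?b \<notin> \<int>\<^sub>\<le>\<^sub>0" "?c \<notin> \<int>\<^sub>\<le>\<^sub>0"
    using assms not_nonpos_Int_real_plus_nat[of _ 0] by (simp_all add: field_simps)
  have "(\<lambda>m. 1/2 * (?g ?a m * ?g ?b m / ?g ?c m)) \<longlonglongrightarrow> 1/2 * (1 * 1 / 1)"
    using n by (intro tendsto_intros Gamma_shift_asymp) auto
  moreover have "1/2 * (?g ?a m * ?g ?b m / ?g ?c m) = real (Suc m) * legendre_Q_coeff \<nu> (Suc m)" for m
  proof -
    have e: "exp (?c * ln (real m)) = exp (?a * ln (real m)) * exp (?b * ln (real m))"
      by (simp add: exp_add[symmetric] field_simps)
    have cancel: "1/2 * (A / (F * X) * (B / (F * Y)) / (C / (F * (X * Y)))) = k * (1/2 * (A * B / (C * (k * F))))"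
      if "X \<noteq> 0" "Y \<noteq> 0" "k \<noteq> 0" "F \<noteq> 0" for A B C F X Y k :: real
      using that by simp
    have f: "(fact (Suc m) :: real) = real (Suc m) * fact m" by simp
    show ?thesis
      unfolding legendre_Q_coeff_def e f by (rule cancel) simp_all
  qed
  ultimately show ?thesis by simp
qed

lemma legendre_Q_coeff_tendsto_0:
  assumes "\<nu> > - 3/2" "\<nu> \<noteq> -1"
  shows "legendre_Q_coeff \<nu> \<longlonglongrightarrow> 0"
proof -
  have "(\<lambda>m. real (Suc m) * legendre_Q_coeff \<nu> (Suc m) * inverse (real (Suc m))) \<longlonglongrightarrow> 1/2 * 0"
    by (intro tendsto_mult legendre_Q_coeff_asymp assms LIMSEQ_inverse_real_of_nat)
  moreover have "x * q * inverse x = q" if "x \<noteq> 0" for x q :: real using that by simp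
  ultimately have "(\<lambda>m. legendre_Q_coeff \<nu> (Suc m)) \<longlonglongrightarrow> 0" by simp
  then show ?thesis by (rule LIMSEQ_imp_Suc)
qed

lemma legendre_Q_fps_radius:
  assumes "\<nu> > - 3/2" "\<nu> \<noteq> -1"
  shows "1 \<le> fps_conv_radius (legendre_Q_fps \<nu>)"
proof -
  have "Bseq (legendre_Q_coeff \<nu>)"
    using legendre_Q_coeff_tendsto_0[OF assms] by (intro convergent_imp_Bseq convergentI)
  then obtain B where B: "0 < B" "\<And>m. \<bar>legendre_Q_coeff \<nu> m\<bar> \<le> B" by (auto elim: BseqE)
  show ?thesis
  proof (rule fps_conv_radius_ge_1_of_linear_bound[where C = B])
    fix n
    have "B * 1 \<le> B * (real n + 1)" using B(1) by (intro mult_left_mono) auto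
    then show "norm (fps_nth (legendre_Q_fps \<nu>) n) \<le> B * (real n + 1)"
      using B(2)[of n] by (simp add: legendre_Q_fps_def)
  qed
qed

lemma legendre_Q_fps_equation:
  assumes "\<nu> > - 3/2" "\<nu> \<noteq> -1"
  shows "hypergeometric_op (of_real (\<nu> + 3/2)) (of_real (\<nu> + 5/2))
    (of_real (- (\<nu> + 1) * (\<nu> + 2) / 4)) (legendre_Q_fps \<nu>) = 0"
proof (rule fps_ext)
  fix n
  have eq: "(real n + 1) * (real n + (\<nu> + 3/2)) * legendre_Q_coeff \<nu> (Suc n)
    - (real n * (real n - 1) + (\<nu> + 5/2) * real n - (- (\<nu> + 1) * (\<nu> + 2) / 4)) * legendre_Q_coeff \<nu> n = 0"
    using legendre_Q_coeff_Suc[OF assms, of n] by (simp add: field_simps)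
  have "fps_nth (hypergeometric_op (of_real (\<nu> + 3/2)) (of_real (\<nu> + 5/2))
      (of_real (- (\<nu> + 1) * (\<nu> + 2) / 4)) (legendre_Q_fps \<nu>)) n =
    of_real ((real n + 1) * (real n + (\<nu> + 3/2)) * legendre_Q_coeff \<nu> (Suc n)
    - (real n * (real n - 1) + (\<nu> + 5/2) * real n - (- (\<nu> + 1) * (\<nu> + 2) / 4)) * legendre_Q_coeff \<nu> n)"
    by (simp add: fps_nth_hypergeometric_op legendre_Q_fps_def)
  then show "fps_nth (hypergeometric_op (of_real (\<nu> + 3/2)) (of_real (\<nu> + 5/2))
      (of_real (- (\<nu> + 1) * (\<nu> + 2) / 4)) (legendre_Q_fps \<nu>)) n = fps_nth 0 n"
    by (simp only: eq) simp
qed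

section \<open>Solutions of the Legendre equation\<close>

text \<open>The first and second derivatives are explicit arguments, so that their boundary behaviour can be
computed from formulas.\<close>
definition legendre_solution ::
  "real \<Rightarrow> complex set \<Rightarrow> (complex \<Rightarrow> complex) \<Rightarrow> (complex \<Rightarrow> complex) \<Rightarrow> (complex \<Rightarrow> complex) \<Rightarrow> bool" where
  "legendre_solution \<nu> S Y Y1 Y2 \<longleftrightarrow> (\<forall>w\<in>S.
     (Y has_field_derivative Y1 w) (at w) \<and> (Y1 has_field_derivative Y2 w) (at w) \<and>
     (1 - w\<^sup>2) * Y2 w - 2 * w * Y1 w + of_real (\<nu> * (\<nu> + 1)) * Y w = 0)"

lemma legendre_solution_subset:
  "legendre_solution \<nu> S Y Y1 Y2 \<Longrightarrow> T \<subseteq> S \<Longrightarrow> legendre_solution \<nu> T Y Y1 Y2"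
  by (auto simp: legendre_solution_def)

lemma legendre_solution_add_cmult:
  assumes "legendre_solution \<nu> S Y Y1 Y2" "legendre_solution \<nu> S Z Z1 Z2"
  shows "legendre_solution \<nu> S (\<lambda>w. Y w + c * Z w) (\<lambda>w. Y1 w + c * Z1 w) (\<lambda>w. Y2 w + c * Z2 w)"
  unfolding legendre_solution_def
proof (intro ballI conjI)
  fix w assume w: "w \<in> S"
  have Y: "(Y has_field_derivative Y1 w) (at w)" "(Y1 has_field_derivative Y2 w) (at w)"
      "(1 - w\<^sup>2) * Y2 w - 2 * w * Y1 w + of_real (\<nu> * (\<nu> + 1)) * Y w = 0"
    and Z: "(Z has_field_derivative Z1 w) (at w)" "(Z1 has_field_derivative Z2 w) (at w)"
      "(1 - w\<^sup>2) * Z2 w - 2 * w * Z1 w + of_real (\<nu> * (\<nu> + 1)) * Z w = 0"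
    using assms w by (auto simp: legendre_solution_def)
  show "((\<lambda>w. Y w + c * Z w) has_field_derivative Y1 w + c * Z1 w) (at w)"
    by (intro DERIV_add DERIV_cmult Y Z)
  show "((\<lambda>w. Y1 w + c * Z1 w) has_field_derivative Y2 w + c * Z2 w) (at w)"
    by (intro DERIV_add DERIV_cmult Y Z)
  have "(1 - w\<^sup>2) * (Y2 w + c * Z2 w) - 2 * w * (Y1 w + c * Z1 w)
      + of_real (\<nu> * (\<nu> + 1)) * (Y w + c * Z w)
    = ((1 - w\<^sup>2) * Y2 w - 2 * w * Y1 w + of_real (\<nu> * (\<nu> + 1)) * Y w)
      + c * ((1 - w\<^sup>2) * Z2 w - 2 * w * Z1 w + of_real (\<nu> * (\<nu> + 1)) * Z w)"
    by (simp only: algebra_simps)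
  then show "(1 - w\<^sup>2) * (Y2 w + c * Z2 w) - 2 * w * (Y1 w + c * Z1 w)
      + of_real (\<nu> * (\<nu> + 1)) * (Y w + c * Z w) = 0"
    unfolding Y(3) Z(3) by simp
qed

text \<open>Abel's identity: \<open>1 - w\<^sup>2\<close> is the integrating factor of the equation for the Wronskian.\<close>
lemma legendre_wronskian_constant:
  assumes Y: "legendre_solution \<nu> S Y Y1 Y2" and Z: "legendre_solution \<nu> S Z Z1 Z2"
    and "convex S"
  shows "\<exists>k. \<forall>w\<in>S. (1 - w\<^sup>2) * (Y1 w * Z w - Y w * Z1 w) = k"
proof (rule has_field_derivative_zero_constant[OF \<open>convex S\<close>])
  fix w assume w: "w \<in> S"
  have Yw: "(Y has_field_derivative Y1 w) (at w)" "(Y1 has_field_derivative Y2 w) (at w)"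
      "(1 - w\<^sup>2) * Y2 w - 2 * w * Y1 w + of_real (\<nu> * (\<nu> + 1)) * Y w = 0"
    and Zw: "(Z has_field_derivative Z1 w) (at w)" "(Z1 has_field_derivative Z2 w) (at w)"
      "(1 - w\<^sup>2) * Z2 w - 2 * w * Z1 w + of_real (\<nu> * (\<nu> + 1)) * Z w = 0"
    using assms w by (auto simp: legendre_solution_def)
  have "((\<lambda>w. (1 - w\<^sup>2) * (Y1 w * Z w - Y w * Z1 w)) has_field_derivative
      (1 - w\<^sup>2) * (Y1 w * Z1 w + Y2 w * Z w - (Y w * Z2 w + Y1 w * Z1 w))
      + (0 - of_nat 2 * (1 * w ^ (2 - Suc 0))) * (Y1 w * Z w - Y w * Z1 w)) (at w)"
    by (intro DERIV_mult' DERIV_diff DERIV_const DERIV_power DERIV_ident Yw(1,2) Zw(1,2))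
  moreover have "(1 - w\<^sup>2) * (Y1 w * Z1 w + Y2 w * Z w - (Y w * Z2 w + Y1 w * Z1 w))
      + (0 - of_nat 2 * (1 * w ^ (2 - Suc 0))) * (Y1 w * Z w - Y w * Z1 w)
    = Z w * ((1 - w\<^sup>2) * Y2 w - 2 * w * Y1 w + of_real (\<nu> * (\<nu> + 1)) * Y w)
      - Y w * ((1 - w\<^sup>2) * Z2 w - 2 * w * Z1 w + of_real (\<nu> * (\<nu> + 1)) * Z w)"
    by (simp add: algebra_simps)
  ultimately show "((\<lambda>w. (1 - w\<^sup>2) * (Y1 w * Z w - Y w * Z1 w)) has_field_derivative 0) (at w within S)"
    unfolding Yw(3) Zw(3) by (auto intro: has_field_derivative_at_within)
qed

lemma norm_half_diff_less_1: "w \<in> ball 1 2 \<Longrightarrow> norm ((1 - w) / 2) < 1" for w :: complex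
  by (simp add: dist_norm norm_divide)

text \<open>The series in the Legendre variable \<open>(1 - w)/2\<close>, for which the unit disc is \<open>\<bar>w - 1\<bar> < 2\<close>.\<close>
definition eval_at_1 :: "complex fps \<Rightarrow> complex \<Rightarrow> complex" where
  "eval_at_1 f w = eval_fps f ((1 - w) / 2)"

lemma has_field_derivative_eval_at_1:
  assumes "norm ((1 - w) / 2) < fps_conv_radius f"
  shows "(eval_at_1 f has_field_derivative - 1/2 * eval_at_1 (fps_deriv f) w) (at w)"
proof -
  have "((\<lambda>w. (1 - w) / 2) has_field_derivative - 1/2) (at w)"
    by (auto intro!: derivative_eq_intros)
  from DERIV_chain2[OF has_field_derivative_eval_fps[OF assms] this]
  show ?thesis unfolding eval_at_1_def[abs_def] by (simp add: mult.commute)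
qed

lemma legendre_op_eval_at_1:
  assumes "1 \<le> fps_conv_radius f" "w \<in> ball 1 2"
  shows "(1 - w\<^sup>2) * (1/4 * eval_at_1 (fps_deriv (fps_deriv f)) w)
      - 2 * w * (- 1/2 * eval_at_1 (fps_deriv f) w) + e * eval_at_1 f w
    = eval_at_1 (hypergeometric_op 1 2 e f) w"
proof -
  have "(1 - (1 - 2 * s)\<^sup>2) * (1/4 * f2) - 2 * (1 - 2 * s) * (- 1/2 * f1) + e * f0
      = s * (1 - s) * f2 + (1 - 2 * s) * f1 + e * f0" for s f0 f1 f2 :: complex
    by (simp add: power2_eq_square algebra_simps)
  moreover have "w = 1 - 2 * ((1 - w) / 2)" by (simp add: field_simps)
  ultimately show ?thesis
    unfolding eval_at_1_def eval_hypergeometric_op[OF assms(1) norm_half_diff_less_1[OF assms(2)]]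
    by metis
qed

lemma legendre_solution_P:
  "legendre_solution \<nu> (ball 1 2) (eval_at_1 (legendre_P_fps \<nu>))
    (\<lambda>w. - 1/2 * eval_at_1 (fps_deriv (legendre_P_fps \<nu>)) w)
    (\<lambda>w. 1/4 * eval_at_1 (fps_deriv (fps_deriv (legendre_P_fps \<nu>))) w)"
  unfolding legendre_solution_def
proof (intro ballI conjI)
  fix w :: complex assume w: "w \<in> ball 1 2"
  note rad = in_disc_of_radius_ge_1[OF legendre_P_fps_radius[of \<nu>] norm_half_diff_less_1[OF w]]
  show "(eval_at_1 (legendre_P_fps \<nu>) has_field_derivative
      - 1/2 * eval_at_1 (fps_deriv (legendre_P_fps \<nu>)) w) (at w)"
    by (rule has_field_derivative_eval_at_1[OF rad(1)])
  show "((\<lambda>w. - 1/2 * eval_at_1 (fps_deriv (legendre_P_fps \<nu>)) w) has_field_derivative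
      1/4 * eval_at_1 (fps_deriv (fps_deriv (legendre_P_fps \<nu>))) w) (at w)"
    using DERIV_cmult[OF has_field_derivative_eval_at_1[OF rad(2)], of "- 1/2"] by simp
  show "(1 - w\<^sup>2) * (1/4 * eval_at_1 (fps_deriv (fps_deriv (legendre_P_fps \<nu>))) w)
      - 2 * w * (- 1/2 * eval_at_1 (fps_deriv (legendre_P_fps \<nu>)) w)
      + of_real (\<nu> * (\<nu> + 1)) * eval_at_1 (legendre_P_fps \<nu>) w = 0"
    unfolding legendre_op_eval_at_1[OF legendre_P_fps_radius w] legendre_P_fps_equation
    by (simp add: eval_at_1_def)
qed

text \<open>The terms of the Legendre operator in which the logarithm is differentiated no longer contain it;
their sum is cancelled by the inhomogeneous equation \<open>frobenius_fps_equation\<close>.\<close>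
lemma legendre_solution_log:
  fixes \<nu> :: real
  defines "P \<equiv> legendre_P_fps \<nu>" and "R \<equiv> frobenius_fps \<nu>"
  shows "legendre_solution \<nu> (ball 1 2 \<inter> {w. w - 1 \<notin> \<real>\<^sub>\<le>\<^sub>0})
    (\<lambda>w. eval_at_1 P w * Ln (w - 1) + eval_at_1 R w)
    (\<lambda>w. - 1/2 * eval_at_1 (fps_deriv P) w * Ln (w - 1) + eval_at_1 P w / (w - 1)
      - 1/2 * eval_at_1 (fps_deriv R) w)
    (\<lambda>w. 1/4 * eval_at_1 (fps_deriv (fps_deriv P)) w * Ln (w - 1)
      - eval_at_1 (fps_deriv P) w / (w - 1) - eval_at_1 P w / (w - 1)\<^sup>2
      + 1/4 * eval_at_1 (fps_deriv (fps_deriv R)) w)"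
  unfolding legendre_solution_def
proof (intro ballI)
  fix w :: complex assume "w \<in> ball 1 2 \<inter> {w. w - 1 \<notin> \<real>\<^sub>\<le>\<^sub>0}"
  then have w: "w \<in> ball 1 2" and nonpos: "w - 1 \<notin> \<real>\<^sub>\<le>\<^sub>0" by auto
  from nonpos have ne: "w - 1 \<noteq> 0" by auto
  note radP = in_disc_of_radius_ge_1[OF legendre_P_fps_radius[of \<nu>] norm_half_diff_less_1[OF w], folded P_def]
  note radR = in_disc_of_radius_ge_1[OF frobenius_fps_radius[of \<nu>] norm_half_diff_less_1[OF w], folded R_def]
  note d = has_field_derivative_eval_at_1[OF radP(1)] has_field_derivative_eval_at_1[OF radP(2)]
    has_field_derivative_eval_at_1[OF radR(1)] has_field_derivative_eval_at_1[OF radR(2)]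
  define p0 p1 p2 r0 r1 r2 l where abbrs: "p0 = eval_at_1 P w" "p1 = eval_at_1 (fps_deriv P) w"
    "p2 = eval_at_1 (fps_deriv (fps_deriv P)) w" "r0 = eval_at_1 R w" "r1 = eval_at_1 (fps_deriv R) w"
    "r2 = eval_at_1 (fps_deriv (fps_deriv R)) w" "l = Ln (w - 1)"
  have log: "((\<lambda>w. Ln (w - 1)) has_field_derivative 1 / (w - 1)) (at w)"
    using nonpos by (auto intro!: derivative_eq_intros simp: inverse_eq_divide)
  have inv: "((\<lambda>w. 1 / (w - 1)) has_field_derivative - (1 / (w - 1)\<^sup>2)) (at w)"
    using ne by (auto intro!: derivative_eq_intros simp: power2_eq_square)
  have d1: "((\<lambda>w. eval_at_1 P w * Ln (w - 1) + eval_at_1 R w) has_field_derivative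
      - 1/2 * p1 * l + p0 / (w - 1) - 1/2 * r1) (at w)"
    using DERIV_add[OF DERIV_mult'[OF d(1) log] d(3)] by (simp add: abbrs algebra_simps)
  have raw: "((\<lambda>w. - 1/2 * (eval_at_1 (fps_deriv P) w * Ln (w - 1)) + eval_at_1 P w * (1 / (w - 1))
      + (- 1/2) * eval_at_1 (fps_deriv R) w) has_field_derivative
      - 1/2 * (p1 * (1 / (w - 1)) + (- 1/2 * p2) * l)
      + (p0 * (- (1 / (w - 1)\<^sup>2)) + (- 1/2 * p1) * (1 / (w - 1))) + (- 1/2) * (- 1/2 * r2)) (at w)"
    unfolding abbrs
    by (intro DERIV_add DERIV_mult' DERIV_cmult log inv d)
  have d2: "((\<lambda>w. - 1/2 * eval_at_1 (fps_deriv P) w * Ln (w - 1) + eval_at_1 P w / (w - 1)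
      - 1/2 * eval_at_1 (fps_deriv R) w) has_field_derivative
      1/4 * p2 * l - p1 / (w - 1) - p0 / (w - 1)\<^sup>2 + 1/4 * r2) (at w)"
  proof -
    have "- 1/2 * (p1 * u + (- 1/2 * p2) * l) + (p0 * (- q) + (- 1/2 * p1) * u) + (- 1/2) * (- 1/2 * r2)
      = 1/4 * p2 * l - p1 * u - p0 * q + 1/4 * r2" for u q
      by (simp add: algebra_simps)
    from this[of "1 / (w - 1)" "1 / (w - 1)\<^sup>2"]
    have "- 1/2 * (p1 * (1 / (w - 1)) + (- 1/2 * p2) * l)
        + (p0 * (- (1 / (w - 1)\<^sup>2)) + (- 1/2 * p1) * (1 / (w - 1))) + (- 1/2) * (- 1/2 * r2)
      = 1/4 * p2 * l - p1 / (w - 1) - p0 / (w - 1)\<^sup>2 + 1/4 * r2"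
      by simp
    moreover have "(\<lambda>w. - 1/2 * (eval_at_1 (fps_deriv P) w * Ln (w - 1)) + eval_at_1 P w * (1 / (w - 1))
        + (- 1/2) * eval_at_1 (fps_deriv R) w)
      = (\<lambda>w. - 1/2 * eval_at_1 (fps_deriv P) w * Ln (w - 1) + eval_at_1 P w / (w - 1)
        - 1/2 * eval_at_1 (fps_deriv R) w)"
      by (simp add: fun_eq_iff)
    ultimately show ?thesis using raw by metis
  qed
  define e where "e = complex_of_real (\<nu> * (\<nu> + 1))"
  have eP: "(1 - w\<^sup>2) * (1/4 * p2) - 2 * w * (- 1/2 * p1) + e * p0 = 0"
    using legendre_op_eval_at_1[OF legendre_P_fps_radius[of \<nu>] w, of e]
    unfolding e_def legendre_P_fps_equation by (simp add: abbrs P_def eval_at_1_def)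
  define z where "z = (1 - w) / 2"
  have in1: "norm z < fps_conv_radius g" if "1 \<le> fps_conv_radius g" for g :: "complex fps"
    unfolding z_def
    using in_disc_of_radius_ge_1[OF that norm_half_diff_less_1[OF w]] by auto
  have P0: "1 \<le> fps_conv_radius P" by (simp add: P_def legendre_P_fps_radius)
  have "(1 - w\<^sup>2) * (1/4 * r2) - 2 * w * (- 1/2 * r1) + e * r0
      = eval_at_1 (P - 2 * (1 - fps_X) * fps_deriv P) w"
    using legendre_op_eval_at_1[OF frobenius_fps_radius[of \<nu>] w, of e]
    unfolding e_def frobenius_fps_equation by (simp add: abbrs P_def R_def)
  also have "\<dots> = p0 - 2 * (1 - z) * p1"
    unfolding eval_at_1_def abbrs z_def[symmetric]
    by (simp add: eval_fps_diff eval_fps_mult in1 fps_conv_radius_ge_1_intros P0)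
  finally have "(1 - w\<^sup>2) * (1/4 * r2) - 2 * w * (- 1/2 * r1) + e * r0 = p0 - 2 * (1 - z) * p1" .
  moreover have "2 * (1 - z) = 1 + w" by (simp add: z_def field_simps)
  ultimately have eR: "(1 - w\<^sup>2) * (1/4 * r2) - 2 * w * (- 1/2 * r1) + e * r0 = p0 - (1 + w) * p1"
    by simp
  define v where "v = 1 / (w - 1)"
  have v: "(w - 1) * v = 1" using ne by (simp add: v_def)
  have "(1 - w\<^sup>2) * (1/4 * p2 * l - p1 * v - p0 * v\<^sup>2 + 1/4 * r2)
      - 2 * w * (- 1/2 * p1 * l + p0 * v - 1/2 * r1) + e * (p0 * l + r0)
    = l * ((1 - w\<^sup>2) * (1/4 * p2) - 2 * w * (- 1/2 * p1) + e * p0)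
      + ((1 - w\<^sup>2) * (1/4 * r2) - 2 * w * (- 1/2 * r1) + e * r0)
      + ((w - 1) * v) * (1 + w) * p1 + ((w - 1) * v) * (1 + w) * v * p0 - 2 * w * v * p0"
    by (simp add: algebra_simps power2_eq_square)
  also have "\<dots> = p0 - (1 + w) * p1 + (1 + w) * p1 + (1 + w) * v * p0 - 2 * w * v * p0"
    unfolding eP eR v by simp
  also have "\<dots> = p0 - ((w - 1) * v) * p0" by (simp add: algebra_simps)
  also have "\<dots> = 0" unfolding v by simp
  finally have eq: "(1 - w\<^sup>2) * (1/4 * p2 * l - p1 / (w - 1) - p0 / (w - 1)\<^sup>2 + 1/4 * r2)
      - 2 * w * (- 1/2 * p1 * l + p0 / (w - 1) - 1/2 * r1) + e * (p0 * l + r0) = 0"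
    by (simp add: v_def power_divide)
  show "((\<lambda>w. eval_at_1 P w * Ln (w - 1) + eval_at_1 R w) has_field_derivative
      - 1/2 * eval_at_1 (fps_deriv P) w * Ln (w - 1) + eval_at_1 P w / (w - 1)
      - 1/2 * eval_at_1 (fps_deriv R) w) (at w) \<and>
    ((\<lambda>w. - 1/2 * eval_at_1 (fps_deriv P) w * Ln (w - 1) + eval_at_1 P w / (w - 1)
      - 1/2 * eval_at_1 (fps_deriv R) w) has_field_derivative
      1/4 * eval_at_1 (fps_deriv (fps_deriv P)) w * Ln (w - 1)
      - eval_at_1 (fps_deriv P) w / (w - 1) - eval_at_1 P w / (w - 1)\<^sup>2
      + 1/4 * eval_at_1 (fps_deriv (fps_deriv R)) w) (at w) \<and>
    (1 - w\<^sup>2) * (1/4 * eval_at_1 (fps_deriv (fps_deriv P)) w * Ln (w - 1)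
      - eval_at_1 (fps_deriv P) w / (w - 1) - eval_at_1 P w / (w - 1)\<^sup>2
      + 1/4 * eval_at_1 (fps_deriv (fps_deriv R)) w)
    - 2 * w * (- 1/2 * eval_at_1 (fps_deriv P) w * Ln (w - 1) + eval_at_1 P w / (w - 1)
      - 1/2 * eval_at_1 (fps_deriv R) w)
    + of_real (\<nu> * (\<nu> + 1)) * (eval_at_1 P w * Ln (w - 1) + eval_at_1 R w) = 0"
    using d1 d2 eq unfolding abbrs e_def by blast
qed

text \<open>The even function \<open>w\<^bsup>\<nu>+1\<^esup> Q\<^sub>\<nu>(w)\<close> in the range \<open>\<bar>w\<bar> > 1\<close>.\<close>
definition legendre_Q_outer :: "real \<Rightarrow> complex \<Rightarrow> complex" where
  "legendre_Q_outer \<nu> w = eval_fps (legendre_Q_fps \<nu>) ((1 / w)\<^sup>2)"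

lemma norm_inverse_square_less_1: "norm w > 1 \<Longrightarrow> norm ((1 / w)\<^sup>2) < 1" for w :: complex
  by (simp add: norm_power norm_divide power_less_one_iff divide_less_eq)

text \<open>The Legendre equation for \<open>w\<^sup>a E(w\<^bsup>-2\<^esup>)\<close> with \<open>a = -\<nu> - 1\<close> becomes the hypergeometric equation of \<open>E\<close>
in \<open>x = w\<^bsup>-2\<^esup>\<close>, multiplied by \<open>-4x w\<^sup>a\<close>.\<close>
lemma legendre_solution_Q:
  fixes \<nu> :: real
  assumes \<nu>: "\<nu> > - 3/2" "\<nu> \<noteq> -1"
  defines "a \<equiv> of_real (- \<nu> - 1) :: complex"
    and "E0 \<equiv> \<lambda>w. eval_fps (legendre_Q_fps \<nu>) ((1 / w)\<^sup>2)"
    and "E1 \<equiv> \<lambda>w. eval_fps (fps_deriv (legendre_Q_fps \<nu>)) ((1 / w)\<^sup>2)"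
    and "E2 \<equiv> \<lambda>w. eval_fps (fps_deriv (fps_deriv (legendre_Q_fps \<nu>))) ((1 / w)\<^sup>2)"
  shows "legendre_solution \<nu> {w. norm w > 1 \<and> w \<notin> \<real>\<^sub>\<le>\<^sub>0}
    (\<lambda>w. w powr a * legendre_Q_outer \<nu> w)
    (\<lambda>w. w powr a * ((1 / w) * (a * E0 w - 2 * (1 / w)\<^sup>2 * E1 w)))
    (\<lambda>w. w powr a * ((1 / w)\<^sup>2 * (a * (a - 1) * E0 w + (6 - 4 * a) * (1 / w)\<^sup>2 * E1 w
      + 4 * ((1 / w)\<^sup>2)\<^sup>2 * E2 w)))"
  unfolding legendre_solution_def legendre_Q_outer_def
proof (intro ballI)
  fix w :: complex assume "w \<in> {w. norm w > 1 \<and> w \<notin> \<real>\<^sub>\<le>\<^sub>0}"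
  then have w: "norm w > 1" and nonpos: "w \<notin> \<real>\<^sub>\<le>\<^sub>0" by auto
  from w have ne: "w \<noteq> 0" by auto
  define v where "v = 1 / w"
  have v: "w * v = 1" using ne by (simp add: v_def)
  define q where "q = w powr a"
  have inv: "((\<lambda>w. 1 / w) has_field_derivative - v\<^sup>2) (at w)"
    using ne by (auto intro!: derivative_eq_intros simp: v_def power2_eq_square)
  have sq: "((\<lambda>w. (1 / w)\<^sup>2) has_field_derivative 2 * v * (- v\<^sup>2)) (at w)"
    using DERIV_power[OF inv, of 2] by (simp add: v_def)
  have pow: "((\<lambda>w. w powr a) has_field_derivative a * (q * v)) (at w)"
    using has_field_derivative_powr[OF nonpos, of a] ne
    by (simp add: q_def v_def powr_diff)
  note rad = in_disc_of_radius_ge_1[OF legendre_Q_fps_radius[OF \<nu>] norm_inverse_square_less_1[OF w]]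
  have D0: "(E0 has_field_derivative E1 w * (2 * v * (- v\<^sup>2))) (at w)"
    unfolding E0_def E1_def by (rule DERIV_chain2[OF has_field_derivative_eval_fps[OF rad(1)] sq])
  have D1: "(E1 has_field_derivative E2 w * (2 * v * (- v\<^sup>2))) (at w)"
    unfolding E1_def E2_def by (rule DERIV_chain2[OF has_field_derivative_eval_fps[OF rad(2)] sq])
  have "((\<lambda>w. w powr a * E0 w) has_field_derivative
      q * (E1 w * (2 * v * (- v\<^sup>2))) + a * (q * v) * E0 w) (at w)"
    unfolding q_def by (rule DERIV_mult'[OF pow[unfolded q_def] D0])
  then have d1: "((\<lambda>w. w powr a * E0 w) has_field_derivative
      q * (v * (a * E0 w - 2 * v\<^sup>2 * E1 w))) (at w)"
    by (simp add: algebra_simps)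
  have "((\<lambda>w. w powr a * ((1 / w) * (a * E0 w - 2 * (1 / w)\<^sup>2 * E1 w))) has_field_derivative
      q * ((1 / w) * (a * (E1 w * (2 * v * (- v\<^sup>2)))
          - (2 * (1 / w)\<^sup>2 * (E2 w * (2 * v * (- v\<^sup>2))) + 2 * (2 * v * (- v\<^sup>2)) * E1 w))
        + (- v\<^sup>2) * (a * E0 w - 2 * (1 / w)\<^sup>2 * E1 w))
      + a * (q * v) * ((1 / w) * (a * E0 w - 2 * (1 / w)\<^sup>2 * E1 w))) (at w)"
    unfolding q_def by (intro DERIV_mult' DERIV_diff DERIV_cmult pow[unfolded q_def] inv sq D0 D1)
  also have "q * ((1 / w) * (a * (E1 w * (2 * v * (- v\<^sup>2)))
          - (2 * (1 / w)\<^sup>2 * (E2 w * (2 * v * (- v\<^sup>2))) + 2 * (2 * v * (- v\<^sup>2)) * E1 w))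
        + (- v\<^sup>2) * (a * E0 w - 2 * (1 / w)\<^sup>2 * E1 w))
      + a * (q * v) * ((1 / w) * (a * E0 w - 2 * (1 / w)\<^sup>2 * E1 w))
    = q * (v\<^sup>2 * (a * (a - 1) * E0 w + (6 - 4 * a) * v\<^sup>2 * E1 w + 4 * (v\<^sup>2)\<^sup>2 * E2 w))"
    unfolding v_def[symmetric] by (simp add: power2_eq_square algebra_simps)
  finally have d2: "((\<lambda>w. w powr a * ((1 / w) * (a * E0 w - 2 * (1 / w)\<^sup>2 * E1 w))) has_field_derivative
      q * (v\<^sup>2 * (a * (a - 1) * E0 w + (6 - 4 * a) * v\<^sup>2 * E1 w + 4 * (v\<^sup>2)\<^sup>2 * E2 w))) (at w)" .
  define x where "x = v\<^sup>2"
  have e: "(of_real (\<nu> * (\<nu> + 1)) :: complex) = a * (a + 1)"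
    "(of_real (\<nu> + 3/2) :: complex) = 1/2 - a" "(of_real (\<nu> + 5/2) :: complex) = 3/2 - a"
    "(of_real (- (\<nu> + 1) * (\<nu> + 2) / 4) :: complex) = - a * (a - 1) / 4"
    by (simp_all add: a_def field_simps)
  have ode: "x * (1 - x) * E2 w + ((1/2 - a) - (3/2 - a) * x) * E1 w + (- a * (a - 1) / 4) * E0 w = 0"
    using eval_hypergeometric_op[OF legendre_Q_fps_radius[OF \<nu>] norm_inverse_square_less_1[OF w],
        of "of_real (\<nu> + 3/2)" "of_real (\<nu> + 5/2)" "of_real (- (\<nu> + 1) * (\<nu> + 2) / 4)"]
    unfolding legendre_Q_fps_equation[OF \<nu>]
    unfolding e x_def v_def E0_def E1_def E2_def by simp
  have wx: "w\<^sup>2 * x = 1" using v by (simp add: x_def flip: power_mult_distrib)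
  have "(1 - w\<^sup>2) * (q * (x * (a * (a - 1) * E0 w + (6 - 4 * a) * x * E1 w + 4 * x\<^sup>2 * E2 w)))
      - 2 * w * (q * (v * (a * E0 w - 2 * x * E1 w))) + a * (a + 1) * (q * E0 w)
    = q * ((x - w\<^sup>2 * x) * (a * (a - 1) * E0 w + (6 - 4 * a) * x * E1 w + 4 * x\<^sup>2 * E2 w)
      - 2 * (w * v) * (a * E0 w - 2 * x * E1 w) + a * (a + 1) * E0 w)"
    by (simp add: algebra_simps)
  also have "\<dots> = - 4 * x * q * (x * (1 - x) * E2 w + ((1/2 - a) - (3/2 - a) * x) * E1 w + (- a * (a - 1) / 4) * E0 w)"
    unfolding v wx by (simp add: field_simps power2_eq_square)
  also have "\<dots> = 0" unfolding ode by simp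
  finally have eq: "(1 - w\<^sup>2) * (q * (v\<^sup>2 * (a * (a - 1) * E0 w + (6 - 4 * a) * v\<^sup>2 * E1 w + 4 * (v\<^sup>2)\<^sup>2 * E2 w)))
      - 2 * w * (q * (v * (a * E0 w - 2 * v\<^sup>2 * E1 w))) + of_real (\<nu> * (\<nu> + 1)) * (q * E0 w) = 0"
    unfolding e x_def .
  show "((\<lambda>w. w powr a * eval_fps (legendre_Q_fps \<nu>) ((1 / w)\<^sup>2)) has_field_derivative
      w powr a * ((1 / w) * (a * E0 w - 2 * (1 / w)\<^sup>2 * E1 w))) (at w) \<and>
    ((\<lambda>w. w powr a * ((1 / w) * (a * E0 w - 2 * (1 / w)\<^sup>2 * E1 w))) has_field_derivative
      w powr a * ((1 / w)\<^sup>2 * (a * (a - 1) * E0 w + (6 - 4 * a) * (1 / w)\<^sup>2 * E1 w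
      + 4 * ((1 / w)\<^sup>2)\<^sup>2 * E2 w))) (at w) \<and>
    (1 - w\<^sup>2) * (w powr a * ((1 / w)\<^sup>2 * (a * (a - 1) * E0 w + (6 - 4 * a) * (1 / w)\<^sup>2 * E1 w
      + 4 * ((1 / w)\<^sup>2)\<^sup>2 * E2 w)))
      - 2 * w * (w powr a * ((1 / w) * (a * E0 w - 2 * (1 / w)\<^sup>2 * E1 w)))
      + of_real (\<nu> * (\<nu> + 1)) * (w powr a * eval_fps (legendre_Q_fps \<nu>) ((1 / w)\<^sup>2)) = 0"
    using d1 d2 eq unfolding v_def q_def E0_def by blast
qed

section \<open>The connection formula between infinity and 1\<close>

lemma tendsto_inverse_square_at_left_1:
  "filterlim (\<lambda>r::real. (1 / (1 + r))\<^sup>2) (at_left 1) (at_right 0)"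
proof (rule filterlim_at_withinI)
  have "((\<lambda>r::real. (1 / (1 + r))\<^sup>2) \<longlongrightarrow> (1 / (1 + 0))\<^sup>2) (at_right 0)"
    by (intro tendsto_intros) auto
  then show "((\<lambda>r::real. (1 / (1 + r))\<^sup>2) \<longlongrightarrow> 1) (at_right 0)" by simp
  have "\<forall>\<^sub>F r in at_right (0::real). r > 0" by (simp add: eventually_at_filter)
  then show "\<forall>\<^sub>F r in at_right (0::real). (1 / (1 + r))\<^sup>2 \<in> {..<1} - {1}"
    by eventually_elim (auto simp: power_one_over divide_simps)
qed

text \<open>The coefficients of \<open>E\<close> tend to \<open>0\<close> and those of \<open>E'\<close> to \<open>1/2\<close>; along \<open>w = 1 + r\<close> the variable
\<open>w\<^bsup>-2\<^esup>\<close> increases to \<open>1\<close>, where the Abelian limit applies.\<close>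
lemma legendre_Q_endpoint_limits:
  assumes \<nu>: "\<nu> > - 3/2" "\<nu> \<noteq> -1"
  shows "((\<lambda>r::real. (1 - (1 / (1 + of_real r))\<^sup>2) * eval_fps (legendre_Q_fps \<nu>) ((1 / (1 + of_real r))\<^sup>2))
      \<longlongrightarrow> 0) (at_right 0)"
    and "((\<lambda>r::real. (1 - (1 / (1 + of_real r))\<^sup>2) * eval_fps (fps_deriv (legendre_Q_fps \<nu>)) ((1 / (1 + of_real r))\<^sup>2))
      \<longlongrightarrow> 1/2) (at_right 0)"
proof -
  have rad: "1 \<le> fps_conv_radius (legendre_Q_fps \<nu>)" by (rule legendre_Q_fps_radius[OF \<nu>])
  then have rad': "1 \<le> fps_conv_radius (fps_deriv (legendre_Q_fps \<nu>))"
    using fps_conv_radius_deriv by (rule order_trans)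
  have "(\<lambda>m. complex_of_real (legendre_Q_coeff \<nu> m)) \<longlonglongrightarrow> of_real 0"
    by (intro tendsto_of_real legendre_Q_coeff_tendsto_0 \<nu>)
  moreover have "fps_nth (legendre_Q_fps \<nu>) = (\<lambda>m. of_real (legendre_Q_coeff \<nu> m))"
    by (simp add: fun_eq_iff legendre_Q_fps_def)
  ultimately have l0: "fps_nth (legendre_Q_fps \<nu>) \<longlonglongrightarrow> 0" by simp
  have "(\<lambda>m. complex_of_real (real (Suc m) * legendre_Q_coeff \<nu> (Suc m))) \<longlonglongrightarrow> of_real (1/2)"
    by (intro tendsto_of_real legendre_Q_coeff_asymp \<nu>)
  moreover have "fps_nth (fps_deriv (legendre_Q_fps \<nu>))
      = (\<lambda>m. of_real (real (Suc m) * legendre_Q_coeff \<nu> (Suc m)))"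
    by (simp add: fun_eq_iff legendre_Q_fps_def)
  ultimately have l1: "fps_nth (fps_deriv (legendre_Q_fps \<nu>)) \<longlonglongrightarrow> 1/2" by simp
  show "((\<lambda>r::real. (1 - (1 / (1 + of_real r))\<^sup>2) * eval_fps (legendre_Q_fps \<nu>) ((1 / (1 + of_real r))\<^sup>2))
      \<longlongrightarrow> 0) (at_right 0)"
    using filterlim_compose[OF abelian_limit[OF l0 rad] tendsto_inverse_square_at_left_1] by simp
  show "((\<lambda>r::real. (1 - (1 / (1 + of_real r))\<^sup>2) * eval_fps (fps_deriv (legendre_Q_fps \<nu>)) ((1 / (1 + of_real r))\<^sup>2))
      \<longlongrightarrow> 1/2) (at_right 0)"
    using filterlim_compose[OF abelian_limit[OF l1 rad'] tendsto_inverse_square_at_left_1] by simp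
qed

lemma tendsto_eval_at_1:
  assumes "1 \<le> fps_conv_radius f"
  shows "((\<lambda>r::real. eval_at_1 f (1 + of_real r)) \<longlongrightarrow> fps_nth f 0) (at_right 0)"
proof -
  have "isCont (eval_at_1 f) 1"
    by (rule DERIV_isCont[OF has_field_derivative_eval_at_1])
      (use in_disc_of_radius_ge_1[OF assms, of 0] in auto)
  moreover have "((\<lambda>r::real. 1 + complex_of_real r) \<longlongrightarrow> 1 + of_real 0) (at_right 0)"
    by (intro tendsto_intros)
  ultimately have "((\<lambda>r::real. eval_at_1 f (1 + of_real r)) \<longlongrightarrow> eval_at_1 f 1) (at_right 0)"
    using isCont_tendsto_compose[of 1 "eval_at_1 f"] by simp
  then show ?thesis by (simp add: eval_at_1_def eval_fps_at_0)
qed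

lemma tendsto_of_real_mult_Ln:
  "((\<lambda>r::real. of_real r * Ln (of_real r)) \<longlongrightarrow> 0) (at_right 0)"
proof -
  have "((\<lambda>r::real. complex_of_real (r * ln r)) \<longlongrightarrow> of_real 0) (at_right 0)"
  proof (rule tendsto_of_real)
    show "((\<lambda>r::real. r * ln r) \<longlongrightarrow> 0) (at_right 0)" by real_asymp
  qed
  moreover have "\<forall>\<^sub>F r in at_right (0::real). complex_of_real (r * ln r) = of_real r * Ln (of_real r)"
  proof -
    have "\<forall>\<^sub>F r in at_right (0::real). r > 0" by (simp add: eventually_at_filter)
    then show ?thesis by eventually_elim (simp add: Ln_of_real)
  qed
  ultimately show ?thesis using Lim_transform_eventually by fastforce
qed

text \<open>Both boundary circles pass through \<open>-1\<close>, so \<open>w \<mapsto> 1/(w + 1)\<close> sends them to the parallel lines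
\<open>Re s = 1/2\<close> and \<open>Re s = 1/4\<close>, and the crescent to the convex strip between them.\<close>
lemma connected_crescent: "connected {w::complex. norm w > 1 \<and> w \<in> ball 1 2}"
proof -
  have "{w::complex. norm w > 1 \<and> w \<in> ball 1 2} = (\<lambda>s. 1 / s - 1) ` {s. 1/4 < Re s \<and> Re s < 1/2}"
    (is "?C = ?f ` ?S")
  proof (intro equalityI subsetI)
    fix w assume w: "w \<in> ?C"
    define s where "s = 1 / (w + 1)"
    have "w \<noteq> -1" using w by auto
    then have ne: "w + 1 \<noteq> 0" by (simp add: eq_neg_iff_add_eq_0)
    have ws: "w = ?f s" using ne by (simp add: s_def)
    define n where "n = (Re w + 1)\<^sup>2 + (Im w)\<^sup>2"
    have "n = (norm (w + 1))\<^sup>2" by (simp add: n_def cmod_power2)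
    then have n: "n > 0" using ne by simp
    have "Re s = (Re w + 1) / n" by (simp add: s_def n_def Re_divide)
    moreover have "(norm w)\<^sup>2 > 1" using w by (simp add: one_less_power)
    then have "2 * (Re w + 1) < n" unfolding cmod_power2 n_def by (simp add: power2_eq_square algebra_simps)
    moreover have "(norm (w - 1))\<^sup>2 < 2\<^sup>2"
      using w by (intro power_strict_mono) (auto simp: dist_norm norm_minus_commute)
    then have "n < 4 * (Re w + 1)" unfolding cmod_power2 n_def by (simp add: power2_eq_square algebra_simps)
    ultimately have "s \<in> ?S" using n by (simp add: pos_less_divide_eq pos_divide_less_eq)
    then show "w \<in> ?f ` ?S" using ws by blast
  next
    fix w assume "w \<in> ?f ` ?S"
    then obtain s where s: "1/4 < Re s" "Re s < 1/2" and w: "w = 1 / s - 1" by auto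
    have ne: "s \<noteq> 0" using s by auto
    have "(norm (1 - s))\<^sup>2 > (norm s)\<^sup>2"
      using s unfolding cmod_power2 by (simp add: power2_eq_square algebra_simps)
    then have "norm (1 - s) > norm s" by (rule power_less_imp_less_base) simp
    moreover have "w = (1 - s) / s" using ne by (simp add: w diff_divide_distrib)
    ultimately have 1: "norm w > 1" using ne by (simp add: norm_divide pos_less_divide_eq)
    have "(norm (1 - 2 * s))\<^sup>2 < (2 * norm s)\<^sup>2"
      using s unfolding power_mult_distrib cmod_power2 by (simp add: power2_eq_square algebra_simps)
    then have "norm (1 - 2 * s) < 2 * norm s" by (rule power_less_imp_less_base) simp
    moreover have "w - 1 = (1 - 2 * s) / s" using ne by (simp add: w diff_divide_distrib)
    ultimately have "norm (w - 1) < 2" using ne by (simp add: norm_divide pos_divide_less_eq)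
    with 1 show "w \<in> ?C" by (simp add: dist_norm norm_minus_commute)
  qed
  moreover have "convex ?S"
  proof -
    have "?S = {s. 1/4 < Re s} \<inter> {s. Re s < 1/2}" by auto
    then show ?thesis by (simp only: convex_Int convex_halfspace_Re_gt convex_halfspace_Re_lt)
  qed
  then have "connected (?f ` ?S)"
    by (intro connected_continuous_image convex_connected continuous_intros) auto
  ultimately show ?thesis by simp
qed

lemma crescent_off_cut:
  fixes w :: complex
  assumes "norm w > 1" "w \<in> ball 1 2"
  shows "w \<notin> \<real>\<^sub>\<le>\<^sub>0" "w - 1 \<notin> \<real>\<^sub>\<le>\<^sub>0"
proof -
  have *: False if "w = of_real r" "r \<le> 1" for r
  proof -
    have "\<bar>r\<bar> > 1" using assms(1) that by simp
    moreover have "dist (of_real 1) (of_real r :: complex) < 2" using assms(2) that by simp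
    then have "\<bar>1 - r\<bar> < 2" by (simp only: dist_of_real dist_real_def)
    ultimately show False using that by auto
  qed
  show "w \<notin> \<real>\<^sub>\<le>\<^sub>0" using * by (force elim: nonpos_Reals_cases)
  show "w - 1 \<notin> \<real>\<^sub>\<le>\<^sub>0"
  proof
    assume "w - 1 \<in> \<real>\<^sub>\<le>\<^sub>0"
    then obtain r where "w - 1 = of_real r" "r \<le> 0" by (elim nonpos_Reals_cases)
    then have "w = of_real (r + 1)" "r + 1 \<le> 1" by (auto simp: algebra_simps)
    then show False using * by blast
  qed
qed

lemma holomorphic_eval_at_1:
  assumes "1 \<le> fps_conv_radius f"
  shows "eval_at_1 f holomorphic_on ball 1 2"
  unfolding holomorphic_on_open[OF open_ball]
  using has_field_derivative_eval_at_1 in_disc_of_radius_ge_1(1)[OF assms norm_half_diff_less_1] by blast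

lemma holomorphic_legendre_Q_outer:
  assumes "\<nu> > - 3/2" "\<nu> \<noteq> -1"
  shows "legendre_Q_outer \<nu> holomorphic_on {w. norm w > 1}"
proof -
  have "(eval_fps (legendre_Q_fps \<nu>) \<circ> (\<lambda>w. (1 / w)\<^sup>2)) holomorphic_on {w. norm w > 1}"
  proof (rule holomorphic_on_compose_gen)
    show "(\<lambda>w::complex. (1 / w)\<^sup>2) holomorphic_on {w. norm w > 1}"
      by (intro holomorphic_intros) auto
    show "eval_fps (legendre_Q_fps \<nu>) holomorphic_on eball 0 (fps_conv_radius (legendre_Q_fps \<nu>))"
      by (intro holomorphic_intros) auto
    show "(\<lambda>w::complex. (1 / w)\<^sup>2) ` {w. norm w > 1} \<subseteq> eball 0 (fps_conv_radius (legendre_Q_fps \<nu>))"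
      using in_disc_of_radius_ge_1(1)[OF legendre_Q_fps_radius[OF assms] norm_inverse_square_less_1]
      by auto
  qed
  then show ?thesis by (simp add: legendre_Q_outer_def[abs_def] o_def)
qed

text \<open>With \<open>D = Q\<^sub>\<nu> + L/2\<close>, where \<open>L\<close> is the logarithmic solution at \<open>1\<close>, the constant
\<open>(1 - w\<^sup>2)(D' P\<^sub>\<nu> - D P\<^sub>\<nu>')\<close> is the limit \<open>1 + (-2)/2 = 0\<close> as \<open>w\<close> decreases to \<open>1\<close>. So \<open>D / P\<^sub>\<nu>\<close> is
constant on a half disc at \<open>1\<close> on which \<open>P\<^sub>\<nu>\<close> has no zero, and the resulting identity is carried to
the crescent by the identity theorem.\<close>
lemma legendre_Q_connection:
  assumes \<nu>: "\<nu> > - 3/2" "\<nu> \<noteq> -1"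
  obtains R where "R holomorphic_on ball 1 2"
    "\<And>w. norm w > 1 \<Longrightarrow> w \<in> ball 1 2 \<Longrightarrow> w powr of_real (- \<nu> - 1) * legendre_Q_outer \<nu> w
      = - 1/2 * eval_at_1 (legendre_P_fps \<nu>) w * Ln (w - 1) + R w"
proof -
  define P where "P = eval_at_1 (legendre_P_fps \<nu>)"
  define P1 where "P1 = (\<lambda>w. - 1/2 * eval_at_1 (fps_deriv (legendre_P_fps \<nu>)) w)"
  define F where "F = eval_at_1 (frobenius_fps \<nu>)"
  define F1 where "F1 = eval_at_1 (fps_deriv (frobenius_fps \<nu>))"
  define a where "a = complex_of_real (- \<nu> - 1)"
  define E0 where "E0 = (\<lambda>w. eval_fps (legendre_Q_fps \<nu>) ((1 / w)\<^sup>2))"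
  define E1 where "E1 = (\<lambda>w. eval_fps (fps_deriv (legendre_Q_fps \<nu>)) ((1 / w)\<^sup>2))"
  define Q where "Q = (\<lambda>w. w powr a * legendre_Q_outer \<nu> w)"
  define Q1 where "Q1 = (\<lambda>w. w powr a * ((1 / w) * (a * E0 w - 2 * (1 / w)\<^sup>2 * E1 w)))"
  define L where "L = (\<lambda>w. P w * Ln (w - 1) + F w)"
  define L1 where "L1 = (\<lambda>w. P1 w * Ln (w - 1) + P w / (w - 1) - 1/2 * F1 w)"
  define D where "D = (\<lambda>w. Q w + 1/2 * L w)"
  define D1 where "D1 = (\<lambda>w. Q1 w + 1/2 * L1 w)"
  let ?C = "{w::complex. norm w > 1 \<and> w \<in> ball 1 2}"
  have holP: "P holomorphic_on ball 1 2" and holF: "F holomorphic_on ball 1 2"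
    unfolding P_def F_def
    by (intro holomorphic_eval_at_1 legendre_P_fps_radius frobenius_fps_radius)+
  have P_1: "P 1 = 1"
    by (simp add: P_def eval_at_1_def eval_fps_at_0 legendre_P_fps_def legendre_P_coeff_def)
  obtain P2 where P2: "legendre_solution \<nu> (ball 1 2) P P1 P2"
    using legendre_solution_P unfolding P_def P1_def by blast
  obtain Q2 where Q2: "legendre_solution \<nu> {w. norm w > 1 \<and> w \<notin> \<real>\<^sub>\<le>\<^sub>0} Q Q1 Q2"
    using legendre_solution_Q[OF \<nu>] unfolding Q_def Q1_def a_def E0_def E1_def by blast
  obtain L2 where L2: "legendre_solution \<nu> (ball 1 2 \<inter> {w. w - 1 \<notin> \<real>\<^sub>\<le>\<^sub>0}) L L1 L2"
    using legendre_solution_log unfolding L_def L1_def P_def P1_def F_def F1_def by blast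
  obtain \<delta> where \<delta>: "0 < \<delta>" "\<delta> \<le> 2" "\<And>w. w \<in> ball 1 \<delta> \<Longrightarrow> P w \<noteq> 0"
  proof -
    have "isCont P 1"
      using holP by (meson centre_in_ball holomorphic_on_imp_continuous_on
          continuous_on_eq_continuous_at open_ball zero_less_numeral)
    then obtain e where "e > 0" and e: "\<And>w. dist 1 w < e \<Longrightarrow> P w \<noteq> 0"
      using continuous_at_avoid[of 1 P 0] P_1 by auto
    then show thesis using that[of "min e 2"] by auto
  qed
  \<comment> \<open>A convex set touching \<open>1\<close>, so that vanishing derivatives give constants and the limit
    at \<open>1\<close> can be taken inside it.\<close>
  define H where "H = ball 1 \<delta> \<inter> {w::complex. Re w > 1}"
  have H_sub: "H \<subseteq> ?C"
  proof
    fix w assume w: "w \<in> H"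
    then have "norm w > 1" using complex_Re_le_cmod[of w] by (auto simp: H_def)
    then show "w \<in> ?C" using w \<delta>(2) by (auto simp: H_def)
  qed
  have "convex H" "open H"
    by (simp_all add: H_def convex_Int convex_halfspace_Re_gt open_Int open_halfspace_Re_gt)
  have "legendre_solution \<nu> ?C Q Q1 Q2" "legendre_solution \<nu> ?C L L1 L2"
    by (rule legendre_solution_subset[OF Q2] legendre_solution_subset[OF L2];
        use crescent_off_cut in auto)+
  from legendre_solution_add_cmult[OF this, of "1/2"]
  obtain D2 where "legendre_solution \<nu> ?C D D1 D2"
    unfolding D_def D1_def by blast
  then have solD: "legendre_solution \<nu> H D D1 D2" by (rule legendre_solution_subset[OF _ H_sub])
  have solP: "legendre_solution \<nu> H P P1 P2"
    using H_sub by (intro legendre_solution_subset[OF P2]) auto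
  obtain k where k: "\<And>w. w \<in> H \<Longrightarrow> (1 - w\<^sup>2) * (D1 w * P w - D w * P1 w) = k"
    using legendre_wronskian_constant[OF solD solP \<open>convex H\<close>] by blast
  have "k = 0"
  proof -
    have limW: "((\<lambda>r::real. 1 + complex_of_real r) \<longlongrightarrow> 1 + of_real 0) (at_right 0)"
      by (intro tendsto_intros)
    have limP: "((\<lambda>r::real. P (1 + of_real r)) \<longlongrightarrow> 1) (at_right 0)"
      using tendsto_eval_at_1[OF legendre_P_fps_radius[of \<nu>]]
      by (simp add: P_def legendre_P_fps_def legendre_P_coeff_def)
    have rad1: "1 \<le> fps_conv_radius (fps_deriv (legendre_P_fps \<nu>))"
      "1 \<le> fps_conv_radius (fps_deriv (frobenius_fps \<nu>))"
      using legendre_P_fps_radius frobenius_fps_radius fps_conv_radius_deriv order_trans by blast+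
    obtain p1 where limP1: "((\<lambda>r::real. P1 (1 + of_real r)) \<longlongrightarrow> p1) (at_right 0)"
      unfolding P1_def using tendsto_mult[OF tendsto_const tendsto_eval_at_1[OF rad1(1)]] by blast
    obtain f0 where limF: "((\<lambda>r::real. F (1 + of_real r)) \<longlongrightarrow> f0) (at_right 0)"
      unfolding F_def using tendsto_eval_at_1[OF frobenius_fps_radius] by blast
    obtain f1 where limF1: "((\<lambda>r::real. F1 (1 + of_real r)) \<longlongrightarrow> f1) (at_right 0)"
      unfolding F1_def using tendsto_eval_at_1[OF rad1(2)] by blast
    have limpow: "((\<lambda>r::real. (1 + of_real r) powr a) \<longlongrightarrow> 1) (at_right 0)"
      using tendsto_powr_complex[OF _ limW tendsto_const[of a]] by simp
    define W where "W = (\<lambda>r::real. 1 + complex_of_real r)"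
    define x where "x = (\<lambda>r. (1 / W r)\<^sup>2)"
    have limW': "(W \<longlongrightarrow> 1) (at_right 0)" using limW by (simp add: W_def)
    have lims: "((\<lambda>r. W r powr a) \<longlongrightarrow> 1) (at_right 0)"
      "((\<lambda>r. P (W r)) \<longlongrightarrow> 1) (at_right 0)" "((\<lambda>r. P1 (W r)) \<longlongrightarrow> p1) (at_right 0)"
      "((\<lambda>r. F (W r)) \<longlongrightarrow> f0) (at_right 0)" "((\<lambda>r. F1 (W r)) \<longlongrightarrow> f1) (at_right 0)"
      unfolding W_def by (fact limpow limP limP1 limF limF1)+
    have limE0: "((\<lambda>r. (1 - x r) * E0 (W r)) \<longlongrightarrow> 0) (at_right 0)"
      and limE1: "((\<lambda>r. (1 - x r) * E1 (W r)) \<longlongrightarrow> 1/2) (at_right 0)"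
      unfolding x_def W_def E0_def E1_def by (rule legendre_Q_endpoint_limits[OF \<nu>])+
    have limr: "((\<lambda>r::real. complex_of_real r) \<longlongrightarrow> 0) (at_right 0)"
      using tendsto_of_real[OF tendsto_ident_at[of 0 "{0<..}"]] by simp
    \<comment> \<open>The Wronskian at \<open>w = 1 + r\<close>, with \<open>1 - w\<^sup>2\<close> written as \<open>-w\<^sup>2(1 - x)\<close> in the terms of \<open>Q\<^sub>\<nu>\<close> and as
      \<open>-r(2 + r)\<close> in those of \<open>L\<close>, so that each factor has a limit.\<close>
    let ?G = "\<lambda>r. (- (W r)\<^sup>2) * (W r powr a * ((1 / W r) *
          (a * ((1 - x r) * E0 (W r)) - 2 * (1 / W r)\<^sup>2 * ((1 - x r) * E1 (W r))))) * P (W r)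
        + (W r)\<^sup>2 * (W r powr a * ((1 - x r) * E0 (W r))) * P1 (W r)
        + 1/2 * (- (2 + of_real r)) * (P1 (W r) * (of_real r * Ln (of_real r)) + P (W r) - 1/2 * (of_real r * F1 (W r))) * P (W r)
        + 1/2 * (2 + of_real r) * (P (W r) * (of_real r * Ln (of_real r)) + of_real r * F (W r)) * P1 (W r)"
    have "(?G \<longlongrightarrow> (- 1\<^sup>2) * (1 * ((1 / 1) * (a * 0 - 2 * (1 / 1)\<^sup>2 * (1/2)))) * 1
        + 1\<^sup>2 * (1 * 0) * p1
        + 1/2 * (- (2 + 0)) * (p1 * 0 + 1 - 1/2 * (0 * f1)) * 1
        + 1/2 * (2 + 0) * (1 * 0 + 0 * f0) * p1) (at_right 0)"
      by (intro tendsto_intros limW' limE0 limE1 limr tendsto_of_real_mult_Ln lims) auto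
    then have "(?G \<longlongrightarrow> 0) (at_right 0)" by simp
    moreover have "\<forall>\<^sub>F r in at_right 0. ?G r = k"
    proof -
      have "\<forall>\<^sub>F r in at_right (0::real). 0 < r \<and> r < \<delta>"
        using \<delta>(1) by (auto simp: eventually_at_right_field)
      then show ?thesis
      proof eventually_elim
        case (elim r)
        have wH: "W r \<in> H" using elim by (auto simp: H_def W_def dist_norm)
        have W0: "W r \<noteq> 0" using elim by (auto simp: W_def complex_eq_iff)
        have Wx: "(W r)\<^sup>2 * x r = 1" using W0 by (simp add: x_def power_divide)
        have 1: "1 - (W r)\<^sup>2 = - (W r)\<^sup>2 * (1 - x r)" using Wx by (simp add: algebra_simps)
        have 2: "1 - (W r)\<^sup>2 = - of_real r * (2 + of_real r)"
          by (simp add: W_def power2_eq_square algebra_simps)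
        have r0: "complex_of_real r \<noteq> 0" and r1: "W r - 1 = of_real r"
          using elim by (auto simp: W_def)
        have cancel: "of_real r * (P (W r) / complex_of_real r) = P (W r)" using r0 by simp
        have "k = (1 - (W r)\<^sup>2) * (Q1 (W r)) * P (W r) - (1 - (W r)\<^sup>2) * Q (W r) * P1 (W r)
            + 1/2 * ((1 - (W r)\<^sup>2) * L1 (W r) * P (W r)) - 1/2 * ((1 - (W r)\<^sup>2) * L (W r) * P1 (W r))"
        proof -
          have "m * ((q' + c * l') * p - (q + c * l) * p')
              = m * q' * p - m * q * p' + c * (m * l' * p) - c * (m * l * p')"
            for m q q' l l' p p' c :: complex
            by (simp add: algebra_simps)
          then show ?thesis unfolding k[OF wH, symmetric] D_def D1_def .
        qed
        also have "(1 - (W r)\<^sup>2) * Q1 (W r) = (- (W r)\<^sup>2) * (W r powr a * ((1 / W r) *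
          (a * ((1 - x r) * E0 (W r)) - 2 * (1 / W r)\<^sup>2 * ((1 - x r) * E1 (W r)))))"
          unfolding 1 Q1_def by (simp only: algebra_simps)
        also have "(1 - (W r)\<^sup>2) * Q (W r) = - ((W r)\<^sup>2 * (W r powr a * ((1 - x r) * E0 (W r))))"
          unfolding 1 Q_def legendre_Q_outer_def E0_def by (simp only: mult_ac mult_minus_left mult_minus_right)
        also have "(1 - (W r)\<^sup>2) * L1 (W r) = - (2 + of_real r) *
            (P1 (W r) * (of_real r * Ln (of_real r)) + of_real r * (P (W r) / of_real r)
              - 1/2 * (of_real r * F1 (W r)))"
        proof -
          have "- s * m * (p' * l + q - h * f) = - m * (p' * (s * l) + s * q - h * (s * f))"
            for s m p' l q h f :: complex
            by (simp add: algebra_simps)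
          then show ?thesis unfolding 2 L1_def r1 .
        qed
        also have "(1 - (W r)\<^sup>2) * L (W r) = - (2 + of_real r) *
            (P (W r) * (of_real r * Ln (of_real r)) + of_real r * F (W r))"
        proof -
          have "- s * m * (p * l + f) = - m * (p * (s * l) + s * f)" for s m p l f :: complex
            by (simp add: algebra_simps)
          then show ?thesis unfolding 2 L_def r1 .
        qed
        also note k_eq = calculation
        have "A * p + B * p' + h * (- m) * X * p + h * m * Y * p'
            = A * p - (- B) * p' + h * (- m * X * p) - h * (- m * Y * p')"
          for A B p p' h m X Y :: complex
          by (simp add: algebra_simps)
        from trans[OF this k_eq[unfolded cancel, symmetric]] show ?case .
      qed
    qed
    ultimately have "((\<lambda>r::real. k) \<longlongrightarrow> 0) (at_right 0)" by (rule Lim_transform_eventually)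
    then show "k = 0" by (simp add: tendsto_const_iff)
  qed
  have dD: "(D has_field_derivative D1 w) (at w)" and dP: "(P has_field_derivative P1 w) (at w)"
    if "w \<in> H" for w
    using solD solP that by (auto simp: legendre_solution_def)
  have "\<exists>c. \<forall>w\<in>H. D w / P w = c"
  proof (rule has_field_derivative_zero_constant[OF \<open>convex H\<close>])
    fix w assume w: "w \<in> H"
    have P0: "P w \<noteq> 0" using w \<delta>(3) by (auto simp: H_def)
    have "Re w > 1" using w by (simp add: H_def)
    then have "w\<^sup>2 \<noteq> 1" by (auto simp: power2_eq_1_iff)
    then have "D1 w * P w - D w * P1 w = 0" using k[OF w] \<open>k = 0\<close> by auto
    then have "((\<lambda>w. D w / P w) has_field_derivative 0) (at w)"
      using DERIV_divide[OF dD[OF w] dP[OF w] P0] by simp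
    then show "((\<lambda>w. D w / P w) has_field_derivative 0) (at w within H)"
      by (rule has_field_derivative_at_within)
  qed
  then obtain c where c: "\<And>w. w \<in> H \<Longrightarrow> D w / P w = c" by blast
  have onH: "Q w = - 1/2 * P w * Ln (w - 1) + (c * P w - 1/2 * F w)" if w: "w \<in> H" for w
  proof -
    have "P w \<noteq> 0" using w \<delta>(3) by (auto simp: H_def)
    then have "D w = c * P w" using c[OF w] by (simp add: field_simps)
    then show ?thesis by (simp add: D_def L_def algebra_simps)
  qed
  have openC: "open ?C"
  proof -
    have "?C = - cball 0 1 \<inter> ball 1 2" by auto
    then show ?thesis by (simp add: open_Int open_Compl)
  qed
  have "H \<noteq> {}"
  proof -
    have "1 + of_real (\<delta> / 2) \<in> H" using \<delta> by (simp add: H_def dist_norm)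
    then show ?thesis by blast
  qed
  have cont: "Q w = - 1/2 * P w * Ln (w - 1) + (c * P w - 1/2 * F w)" if w: "w \<in> ?C" for w
  proof (rule analytic_continuation_open[OF \<open>open H\<close> openC \<open>H \<noteq> {}\<close> connected_crescent H_sub _ _ onH w])
    have "legendre_Q_outer \<nu> holomorphic_on ?C"
      by (rule holomorphic_on_subset[OF holomorphic_legendre_Q_outer[OF \<nu>]]) auto
    then show "Q holomorphic_on ?C"
      unfolding Q_def by (intro holomorphic_intros) (auto dest: crescent_off_cut)
    have "P holomorphic_on ?C" "F holomorphic_on ?C"
      by (auto intro: holomorphic_on_subset[OF holP] holomorphic_on_subset[OF holF])
    then show "(\<lambda>w. - 1/2 * P w * Ln (w - 1) + (c * P w - 1/2 * F w)) holomorphic_on ?C"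
      by (intro holomorphic_intros) (auto dest: crescent_off_cut)
  qed
  show thesis
  proof (rule that[of "\<lambda>w. c * P w - 1/2 * F w"])
    show "(\<lambda>w. c * P w - 1/2 * F w) holomorphic_on ball 1 2"
      by (intro holomorphic_intros holP holF)
  qed (use cont in \<open>auto simp: Q_def P_def a_def\<close>)
qed

section \<open>Continuation to the complement of [-1, 1]\<close>

abbreviation unit_cut :: "complex set" where "unit_cut \<equiv> of_real ` {-1..1}"

abbreviation left_cut :: "complex set" where "left_cut \<equiv> of_real ` {..1}"

lemma of_real_image_iff: "w \<in> of_real ` A \<longleftrightarrow> Im w = 0 \<and> Re w \<in> A" for w :: complex
  by (auto simp: complex_eq_iff intro!: image_eqI[of _ _ "Re w"])

lemma open_unit_cut_complement: "open (- unit_cut)"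
  by (intro open_Compl compact_imp_closed compact_continuous_image continuous_intros) simp

lemma connected_unit_cut_complement: "connected (- unit_cut)"
proof (rule connected_complement_bounded_convex)
  show "bounded unit_cut"
    by (intro compact_imp_bounded compact_continuous_image continuous_intros) simp
  show "convex unit_cut" by (intro convex_linear_image) auto
qed simp

lemma open_left_cut_complement: "open (- left_cut)"
proof -
  have "left_cut = {w. Im w = 0} \<inter> {w. Re w \<le> 1}" by (auto simp: of_real_image_iff)
  then show ?thesis
    by (simp only: closed_halfspace_Im_eq closed_halfspace_Re_le closed_Int open_Compl)
qed

text \<open>The set is star-shaped about \<open>2\<close>.\<close>
lemma connected_left_cut_complement: "connected (- left_cut)"
proof (rule starlike_imp_connected)
  have "closed_segment 2 w \<subseteq> - left_cut" if w: "w \<in> - left_cut" for w :: complex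
  proof
    fix z assume "z \<in> closed_segment 2 w"
    then obtain u where u: "0 \<le> u" "u \<le> 1" and z: "z = (1 - u) *\<^sub>R 2 + u *\<^sub>R w"
      by (auto simp: closed_segment_def)
    have "\<not> (Im z = 0 \<and> Re z \<le> 1)"
    proof
      assume z1: "Im z = 0 \<and> Re z \<le> 1"
      then have "u = 0 \<or> Im w = 0" by (simp add: z)
      then show False
      proof
        assume "Im w = 0"
        then have "Re w > 1" using w by (auto simp: of_real_image_iff)
        then have "0 \<le> u * (Re w - 1)" using u by simp
        moreover have "Re z - 1 = (1 - u) + u * (Re w - 1)" by (simp add: z algebra_simps)
        ultimately have "u = 1" using z1 u by simp
        then show False using z1 \<open>Re w > 1\<close> by (simp add: z)
      qed (use z1 in \<open>simp add: z\<close>)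
    qed
    then show "z \<in> - left_cut" by (auto simp: of_real_image_iff)
  qed
  moreover have "(2::complex) \<in> - left_cut" by (simp add: of_real_image_iff)
  ultimately show "starlike (- left_cut)" unfolding starlike_def by blast
qed

lemma outside_unit_cut: "norm w > 1 \<Longrightarrow> w \<notin> unit_cut" for w :: complex
  by (auto simp: norm_of_real)

lemma unit_cut_subset_left_cut: "unit_cut \<subseteq> left_cut" by auto

lemma ball_off_unit_cut:
  fixes w :: complex
  assumes "w \<in> ball 1 2" "w \<notin> unit_cut"
  shows "w \<notin> \<real>\<^sub>\<le>\<^sub>0" "w - 1 \<notin> \<real>\<^sub>\<le>\<^sub>0"
proof -
  have *: False if "Im w = 0" "Re w \<le> 1"
  proof -
    have "\<bar>Re (1 - w)\<bar> < 2"
      using assms(1) abs_Re_le_cmod[of "1 - w"] by (simp add: dist_norm)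
    then show False using assms(2) that by (auto simp: of_real_image_iff)
  qed
  show "w \<notin> \<real>\<^sub>\<le>\<^sub>0" "w - 1 \<notin> \<real>\<^sub>\<le>\<^sub>0"
    using * by (auto simp: complex_nonpos_Reals_iff)
qed

text \<open>The unit circle touches the circle \<open>\<bar>w - 1\<bar> = 2\<close> from inside at \<open>-1\<close>, a point of the cut. Hence the
connection formula alone covers everything that the series at infinity misses.\<close>
lemma in_ball_1_2_of_norm_le_1:
  fixes w :: complex
  assumes "norm w \<le> 1" "w \<notin> unit_cut"
  shows "w \<in> ball 1 2"
proof -
  have Re: "Re w > -1"
  proof (rule ccontr)
    assume "\<not> Re w > -1"
    then have R: "Re w \<le> -1" by simp
    have n: "(Re w)\<^sup>2 + (Im w)\<^sup>2 \<le> 1"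
      using assms(1) power_mono[of "norm w" 1 2] by (simp add: cmod_power2)
    have "1 \<le> (Re w)\<^sup>2" using R abs_le_square_iff[of 1 "Re w"] by simp
    with n have "(Im w)\<^sup>2 \<le> 0" by linarith
    then have "Im w = 0" by simp
    moreover have "Re w \<ge> -1" using assms(1) abs_Re_le_cmod[of w] by linarith
    ultimately have "w \<in> unit_cut" using R by (auto simp: of_real_image_iff)
    then show False using assms(2) by simp
  qed
  have "(norm (w - 1))\<^sup>2 = (norm w)\<^sup>2 - 2 * Re w + 1"
    unfolding cmod_power2 by (simp add: power2_eq_square algebra_simps)
  moreover have "(norm w)\<^sup>2 \<le> 1" using assms(1) by (simp add: power_le_one)
  ultimately have "(norm (w - 1))\<^sup>2 < 2\<^sup>2" using Re by simp
  then have "norm (w - 1) < 2" by (rule power_less_imp_less_base) simp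
  then show ?thesis by (simp add: dist_norm norm_minus_commute)
qed

text \<open>\<open>G\<close> is \<open>w\<^bsup>\<nu>+1\<^esup> Q\<^sub>\<nu>(w)\<close>. Inside the unit disc it is defined by the connection formula, whose two
branch cuts, from the power and from the logarithm, meet the disc \<open>\<bar>w - 1\<bar> < 2\<close> only in \<open>[-1, 1]\<close>.
Outside it is a series in \<open>w\<^bsup>-2\<^esup>\<close>, hence even there, and then everywhere by the identity theorem.\<close>
lemma legendre_Q_even_extension:
  assumes \<nu>: "\<nu> > - 3/2" "\<nu> \<noteq> -1"
  obtains G R where "G holomorphic_on - unit_cut"
    "\<And>w. norm w > 1 \<Longrightarrow> G w = legendre_Q_outer \<nu> w"
    "\<And>w. w \<notin> unit_cut \<Longrightarrow> G (- w) = G w"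
    "R holomorphic_on ball 1 2"
    "\<And>w. w \<in> ball 1 2 \<Longrightarrow> w \<notin> unit_cut \<Longrightarrow> w powr of_real (- \<nu> - 1) * G w
      = - 1/2 * eval_at_1 (legendre_P_fps \<nu>) w * Ln (w - 1) + R w"
proof -
  obtain R where R: "R holomorphic_on ball 1 2" and conn:
    "\<And>w. norm w > 1 \<Longrightarrow> w \<in> ball 1 2 \<Longrightarrow> w powr of_real (- \<nu> - 1) * legendre_Q_outer \<nu> w
      = - 1/2 * eval_at_1 (legendre_P_fps \<nu>) w * Ln (w - 1) + R w"
    using legendre_Q_connection[OF \<nu>] by blast
  define X where "X = (\<lambda>w. w powr of_real (\<nu> + 1) *
    (- 1/2 * eval_at_1 (legendre_P_fps \<nu>) w * Ln (w - 1) + R w))"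
  define G where "G = (\<lambda>w. if norm w > 1 then legendre_Q_outer \<nu> w else X w)"
  define U where "U = ball 1 2 - unit_cut"
  have openU: "open U"
    using open_unit_cut_complement by (simp add: U_def open_Int Diff_eq)
  have cancel: "w powr of_real (\<nu> + 1) * w powr of_real (- \<nu> - 1) = 1" if "w \<noteq> 0" for w :: complex
    using that by (simp add: powr_def flip: exp_add) (simp add: algebra_simps)
  have cancel': "w powr of_real (\<nu> + 1) * (w powr of_real (- \<nu> - 1) * q) = q"
    and cancel'': "w powr of_real (- \<nu> - 1) * (w powr of_real (\<nu> + 1) * q) = q"
    if "w \<noteq> 0" for w q :: complex
    using cancel[OF that] by (metis mult.assoc mult.commute mult_1_left)+
  have GU: "G w = X w" if "w \<in> U" for w
  proof (cases "norm w > 1")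
    case True
    then have "w \<noteq> 0" by auto
    moreover have "X w = w powr of_real (\<nu> + 1) * (w powr of_real (- \<nu> - 1) * legendre_Q_outer \<nu> w)"
      using True that by (simp only: X_def U_def conn Diff_iff)
    ultimately show ?thesis using True by (simp only: G_def cancel' if_True not_False_eq_True)
  qed (simp add: G_def)
  have holP: "eval_at_1 (legendre_P_fps \<nu>) holomorphic_on U" "R holomorphic_on U"
    by (rule holomorphic_on_subset[OF holomorphic_eval_at_1[OF legendre_P_fps_radius]]
        holomorphic_on_subset[OF R], simp add: U_def)+
  have holX: "X holomorphic_on U"
    unfolding X_def using holP
    by (intro holomorphic_intros) (auto simp: U_def simp del: mem_ball dest: ball_off_unit_cut)
  have open1: "open {w::complex. norm w > 1}"
    by (intro open_Collect_less continuous_intros)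
  have holG: "G holomorphic_on - unit_cut"
    unfolding holomorphic_on_def
  proof
    fix w assume w: "w \<in> - unit_cut"
    have "G field_differentiable at w"
    proof (cases "norm w > 1")
      case True
      have "G holomorphic_on {w. norm w > 1}"
        by (rule holomorphic_transform[OF holomorphic_legendre_Q_outer[OF \<nu>]]) (simp add: G_def)
      then show ?thesis using True open1 holomorphic_on_imp_differentiable_at by blast
    next
      case False
      then have "w \<in> U" using w in_ball_1_2_of_norm_le_1[of w] by (simp add: U_def)
      moreover have "G holomorphic_on U"
        by (rule holomorphic_transform[OF holX]) (simp add: GU)
      ultimately show ?thesis using openU holomorphic_on_imp_differentiable_at by blast
    qed
    then show "G field_differentiable at w within - unit_cut"
      by (rule field_differentiable_at_within)
  qed
  have sym: "- w \<in> - unit_cut" if "w \<in> - unit_cut" for w :: complex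
    using that by (auto simp: of_real_image_iff)
  have even: "G (- w) = G w" if "w \<notin> unit_cut" for w
  proof (rule analytic_continuation_open[where s = "{w. norm w > 1}" and s' = "- unit_cut"
        and f = "\<lambda>w. G (- w)" and g = G])
    have "(G \<circ> uminus) holomorphic_on - unit_cut"
      by (rule holomorphic_on_compose_gen[OF _ holG]) (use sym in \<open>auto intro!: holomorphic_intros\<close>)
    then show "(\<lambda>w. G (- w)) holomorphic_on - unit_cut" by (simp add: o_def)
    have "norm (2::complex) > 1" by simp
    then show "{w::complex. norm w > 1} \<noteq> {}" by blast
    show "{w. norm w > 1} \<subseteq> - unit_cut" using outside_unit_cut by blast
    show "G (- z) = G z" if "z \<in> {w. norm w > 1}" for z
      using that by (simp add: G_def legendre_Q_outer_def)
  qed (use that holG open1 open_unit_cut_complement connected_unit_cut_complement in auto)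
  show thesis
  proof (rule that[OF holG _ even R])
    show "G w = legendre_Q_outer \<nu> w" if "norm w > 1" for w using that by (simp add: G_def)
    show "w powr of_real (- \<nu> - 1) * G w
      = - 1/2 * eval_at_1 (legendre_P_fps \<nu>) w * Ln (w - 1) + R w" if "w \<in> ball 1 2" "w \<notin> unit_cut" for w
    proof -
      have "w \<noteq> 0" using ball_off_unit_cut(1)[OF that] by auto
      moreover have "G w = X w" using that GU by (simp add: U_def)
      ultimately show ?thesis by (simp only: X_def cancel'' not_False_eq_True)
    qed
  qed auto
qed

lemma legendre_Q_outer_sums:
  assumes "\<nu> > - 3/2" "\<nu> \<noteq> -1" "norm w > 1"
  shows "(\<lambda>m. of_real (legendre_Q_coeff \<nu> m) * (1 / w) ^ (2 * m)) sums legendre_Q_outer \<nu> w"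
  using sums_eval_fps[OF in_disc_of_radius_ge_1(1)[OF legendre_Q_fps_radius[OF assms(1,2)]
        norm_inverse_square_less_1[OF assms(3)]]]
  by (simp add: legendre_Q_outer_def legendre_Q_fps_def power_mult)

lemma legendre_Q_series_eq:
  assumes \<nu>: "\<nu> > - 3/2" "\<nu> \<noteq> -1" and w: "norm w > 1"
  shows "legendre_Q_series \<nu> w = w powr of_real (- \<nu> - 1) * legendre_Q_outer \<nu> w"
proof -
  have w0: "w \<noteq> 0" using w by auto
  have "w powr of_real (- 2 * real m - \<nu> - 1) = w powr of_real (- \<nu> - 1) * (1 / w) ^ (2 * m)" for m
  proof -
    have "w powr of_real (- 2 * real m - \<nu> - 1) = w powr (of_real (- \<nu> - 1) - of_nat (2 * m))"
      by (rule arg_cong[where f = "\<lambda>a. w powr a"]) simp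
    also have "\<dots> = w powr of_real (- \<nu> - 1) / w ^ (2 * m)"
      using w0 by (simp only: powr_diff powr_nat' simp_thms)
    also have "\<dots> = w powr of_real (- \<nu> - 1) * (1 / w) ^ (2 * m)"
      by (simp only: power_one_over mult_1_right times_divide_eq_right)
    finally show ?thesis .
  qed
  then have "legendre_Q_series \<nu> w = 1/2 * (\<Sum>m. 2 * w powr of_real (- \<nu> - 1) *
      (of_real (legendre_Q_coeff \<nu> m) * (1 / w) ^ (2 * m)))"
    unfolding legendre_Q_series_def legendre_Q_coeff_def
    by (simp add: mult_ac)
  also have "\<dots> = 1/2 * (2 * w powr of_real (- \<nu> - 1) * legendre_Q_outer \<nu> w)"
    using sums_unique[OF sums_mult[OF legendre_Q_outer_sums[OF \<nu> w]]] by metis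
  finally show ?thesis by simp
qed

lemma legendre_Q_eq:
  assumes \<nu>: "\<nu> > - 3/2" "\<nu> \<noteq> -1"
    and G: "G holomorphic_on - unit_cut" "\<And>w. norm w > 1 \<Longrightarrow> G w = legendre_Q_outer \<nu> w"
    and w: "w \<notin> left_cut"
  shows "legendre_Q \<nu> w = w powr of_real (- \<nu> - 1) * G w"
  unfolding legendre_Q_def
proof (rule analytic_ext_eqI[where \<xi> = 2])
  show "of_real ` {1<..} \<subseteq> - left_cut" by auto
  show "(2::complex) islimpt of_real ` {1<..}"
    unfolding islimpt_approachable
  proof (intro allI impI)
    fix e :: real assume "e > 0"
    then show "\<exists>x'\<in>of_real ` {1<..}. x' \<noteq> 2 \<and> dist x' (2::complex) < e"
      by (intro bexI[of _ "of_real (2 + e/2)"]) (auto simp: dist_norm of_real_image_iff)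
  qed
  have "G holomorphic_on - left_cut"
    by (rule holomorphic_on_subset[OF G(1)]) auto
  then show "(\<lambda>w. w powr of_real (- \<nu> - 1) * G w) holomorphic_on - left_cut"
    by (intro holomorphic_intros) (auto simp: of_real_image_iff complex_nonpos_Reals_iff)
  show "z powr of_real (- \<nu> - 1) * G z = legendre_Q_series \<nu> z" if "z \<in> of_real ` {1<..}" for z
  proof -
    have "norm z > 1" using that by auto
    then show ?thesis by (simp add: legendre_Q_series_eq[OF \<nu>] G(2))
  qed
qed (use w open_left_cut_complement connected_left_cut_complement in \<open>auto simp: of_real_image_iff\<close>)

lemma Psi_series_eq:
  assumes b: "b > - 1/2" "b \<noteq> 0" and w: "norm w > 1"
  shows "Psi_series b w = of_real b * legendre_Q_outer (b - 1) w - of_real b * (legendre_Q_outer b w / w)"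
proof -
  have s1: "(\<lambda>m. of_real (2 * b) * (of_real (legendre_Q_coeff (b - 1) m) * (1 / w) ^ (2 * m)))
      sums (of_real (2 * b) * legendre_Q_outer (b - 1) w)"
    using b w by (intro sums_mult legendre_Q_outer_sums) auto
  have s2: "(\<lambda>m. 2 * (1 / w) * (of_real (legendre_Q_coeff b m) * (1 / w) ^ (2 * m)))
      sums (2 * (1 / w) * legendre_Q_outer b w)"
    using b w by (intro sums_mult legendre_Q_outer_sums) auto
  have arg: "b - 1 + 1 = b" "b - 1 + 2 = b + 1" "b - 1 + 3/2 = b + 1/2" by simp_all
  have 1: "of_real (b_Gamma b m * Gamma ((b + 1) / 2 + real m) / (Gamma (b + 1/2 + real m) * fact m)) * (1 / w) ^ (2 * m)
      = of_real (2 * b) * (of_real (legendre_Q_coeff (b - 1) m) * (1 / w) ^ (2 * m))" for m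
    using b by (simp add: b_Gamma_def legendre_Q_coeff_def arg)
  have 2: "of_real (Gamma ((b + 1) / 2 + real m) * Gamma ((b + 2) / 2 + real m) / (Gamma (b + 3/2 + real m) * fact m)) * (1 / w) ^ (2 * m + 1)
      = 2 * (1 / w) * (of_real (legendre_Q_coeff b m) * (1 / w) ^ (2 * m))" for m
    by (simp add: legendre_Q_coeff_def mult_ac)
  show ?thesis
    unfolding Psi_series_def 1 2 sums_unique[OF s1, symmetric] sums_unique[OF s2, symmetric]
    by simp
qed

lemma Psi_eqI:
  assumes "g holomorphic_on - unit_cut" "\<And>w. norm w > 1 \<Longrightarrow> g w = Psi_series b w" "w \<notin> unit_cut"
  shows "Psi b w = g w"
  unfolding Psi_def
proof (rule analytic_ext_eqI[where \<xi> = 2])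
  have "open {w::complex. norm w > 1}" by (intro open_Collect_less continuous_intros)
  then show "(2::complex) islimpt {w. norm w > 1}"
    by (intro interior_limit_point) (simp add: interior_open)
  show "{w. norm w > 1} \<subseteq> - unit_cut" using outside_unit_cut by blast
qed (use assms open_unit_cut_complement connected_unit_cut_complement in \<open>auto simp: of_real_image_iff\<close>)

text \<open>For \<open>m = 0\<close> use \<open>a \<Gamma>(a/2) = 2 \<Gamma>(a/2 + 1)\<close>; for \<open>m > 0\<close> the Gamma function is continuous at \<open>m\<close>.\<close>
lemma b_Gamma_0: "b_Gamma 0 m = (if m = 0 then 2 else 0)"
proof -
  have "((\<lambda>a::real. a * Gamma (a / 2 + real m)) \<longlongrightarrow> (if m = 0 then 2 else 0)) (at 0)"
  proof (cases "m = 0")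
    case True
    have "((\<lambda>a::real. 2 * Gamma (a / 2 + 1)) \<longlongrightarrow> 2 * Gamma (0 / 2 + 1)) (at 0)"
      by (intro tendsto_intros) auto
    moreover have "\<forall>\<^sub>F a::real in at 0. 2 * Gamma (a / 2 + 1) = a * Gamma (a / 2 + real m)"
    proof -
      have "\<forall>\<^sub>F a::real in at 0. a \<noteq> 0 \<and> a \<in> {-1<..<1}"
        by (intro eventually_conj eventually_at_in_open' eventually_neq_at_within) auto
      then show ?thesis
      proof eventually_elim
        case (elim a)
        then have "a / 2 + real 0 \<notin> \<int>\<^sub>\<le>\<^sub>0" by (intro not_nonpos_Int_real_plus_nat) auto
        then show ?case using True by (simp add: Gamma_plus1)
      qed
    qed
    ultimately show ?thesis using True Lim_transform_eventually by fastforce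
  next
    case False
    have "((\<lambda>a::real. a * Gamma (a / 2 + real m)) \<longlongrightarrow> 0 * Gamma (0 / 2 + real m)) (at 0)"
      using False by (intro tendsto_intros) auto
    then show ?thesis using False by simp
  qed
  then show ?thesis unfolding b_Gamma_def by (simp add: tendsto_Lim)
qed

lemma Psi_0: "w \<notin> unit_cut \<Longrightarrow> Psi 0 w = 1"
proof (rule Psi_eqI)
  fix w :: complex
  have "(\<lambda>m. of_real (b_Gamma 0 m * Gamma ((0 + 1) / 2 + real m)
      / (Gamma (0 + 1/2 + real m) * fact m)) * (1 / w) ^ (2 * m)) = (\<lambda>m. if m = 0 then 2 else 0)"
    by (auto simp: b_Gamma_0 fun_eq_iff Gamma_one_half_real)
  moreover have "(\<Sum>m. if m = 0 then 2 else 0) = (2::complex)"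
    using suminf_finite[of "{0::nat}" "\<lambda>m. if m = 0 then 2 else 0 :: complex"] by simp
  ultimately show "1 = Psi_series 0 w"
    unfolding Psi_series_def by simp
qed auto

section \<open>The jump of Q across the real axis\<close>

text \<open>The upper half-plane for \<open>s = 1\<close> and the lower one for \<open>s = -1\<close>; the sign as a parameter lets one
statement describe both boundary values.\<close>
definition half_plane :: "real \<Rightarrow> complex set" where
  "half_plane s = {w. 0 < s * Im w}"

lemma Ln_half_plane_limit:
  fixes r :: real
  assumes s: "s \<in> {1, -1}" and r: "r < 0"
  shows "(Ln \<longlongrightarrow> of_real (ln (- r)) + of_real s * \<i> * of_real pi) (at (of_real r) within half_plane s)"
proof -
  have "((\<lambda>w. Ln (- w)) \<longlongrightarrow> Ln (- of_real r)) (at (of_real r) within half_plane s)"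
    using r by (intro tendsto_intros) (auto simp: complex_nonpos_Reals_iff)
  then have lim: "((\<lambda>w. Ln (- w) + of_real s * \<i> * of_real pi) \<longlongrightarrow> Ln (- of_real r) + of_real s * \<i> * of_real pi)
      (at (of_real r) within half_plane s)"
    by (rule tendsto_add[OF _ tendsto_const])
  have val: "Ln (- of_real r) = of_real (ln (- r))"
    using r Ln_of_real[of "- r"] by simp
  have ev: "\<forall>\<^sub>F w in at (of_real r) within half_plane s. Ln (- w) + of_real s * \<i> * of_real pi = Ln w"
    unfolding eventually_at_filter
  proof (rule always_eventually, intro allI impI)
    fix w assume "w \<noteq> complex_of_real r" "w \<in> half_plane s"
    then have w: "0 < s * Im w" by (simp add: half_plane_def)
    then have "- w \<noteq> 0" by auto
    from Ln_minus[OF this] show "Ln (- w) + of_real s * \<i> * of_real pi = Ln w"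
      using s w by auto
  qed
  show ?thesis using Lim_transform_eventually[OF lim ev] unfolding val .
qed

lemma powr_half_plane_limit:
  fixes r :: real
  assumes "s \<in> {1, -1}" "r < 0"
  shows "((\<lambda>w. w powr a) \<longlongrightarrow> exp (a * of_real s * \<i> * of_real pi) * of_real (- r) powr a)
    (at (of_real r) within half_plane s)"
proof -
  have lim: "((\<lambda>w. exp (a * Ln w)) \<longlongrightarrow> exp (a * (of_real (ln (- r)) + of_real s * \<i> * of_real pi)))
      (at (of_real r) within half_plane s)"
    by (intro tendsto_intros Ln_half_plane_limit assms)
  have val: "exp (a * (of_real (ln (- r)) + of_real s * \<i> * of_real pi))
      = exp (a * of_real s * \<i> * of_real pi) * of_real (- r) powr a"
    using assms(2) Ln_of_real[of "- r"]
    by (simp add: powr_def distrib_left exp_add mult.commute mult.left_commute)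
  have ev: "\<forall>\<^sub>F w in at (of_real r) within half_plane s. exp (a * Ln w) = w powr a"
    unfolding eventually_at_filter
    by (rule always_eventually) (auto simp: powr_def half_plane_def)
  show ?thesis using Lim_transform_eventually[OF lim ev] unfolding val .
qed

lemma eval_at_1_legendre_P:
  assumes "-1 < u" "u < 1"
  shows "eval_at_1 (legendre_P_fps \<nu>) (of_real u) = of_real (legendre_P \<nu> u)"
proof -
  have n: "norm ((1 - complex_of_real u) / 2) < 1"
  proof -
    have "norm ((1 - complex_of_real u) / 2) = norm (complex_of_real ((1 - u) / 2))" by simp
    also have "\<dots> = \<bar>(1 - u) / 2\<bar>" by (rule norm_of_real)
    finally show ?thesis using assms by simp
  qed
  let ?c = "\<lambda>m. legendre_P_coeff \<nu> m * ((1 - u) / 2) ^ m"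
  have "(\<lambda>m. fps_nth (legendre_P_fps \<nu>) m * ((1 - complex_of_real u) / 2) ^ m) sums
      eval_at_1 (legendre_P_fps \<nu>) (of_real u)"
    unfolding eval_at_1_def
    by (rule sums_eval_fps[OF in_disc_of_radius_ge_1(1)[OF legendre_P_fps_radius n]])
  then have s: "(\<lambda>m. complex_of_real (?c m)) sums eval_at_1 (legendre_P_fps \<nu>) (of_real u)"
    by (simp add: legendre_P_fps_def)
  then have "summable ?c" using sums_summable summable_complex_of_real by blast
  then have "(\<lambda>m. complex_of_real (?c m)) sums of_real (suminf ?c)"
    by (intro sums_of_real summable_sums)
  with s have "eval_at_1 (legendre_P_fps \<nu>) (of_real u) = of_real (suminf ?c)" by (rule sums_unique2)
  then show ?thesis by (simp add: legendre_P_def legendre_P_coeff_def)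
qed

lemma half_plane_off_left_cut: "w \<in> half_plane s \<Longrightarrow> w \<notin> left_cut"
  by (auto simp: half_plane_def)

lemma holomorphic_tendsto_within:
  assumes "f holomorphic_on S" "open S" "z \<in> S"
  shows "(f \<longlongrightarrow> f z) (at z within A)"
proof -
  have "isCont f z"
    using assms continuous_on_eq_continuous_at holomorphic_on_imp_continuous_on by blast
  then show ?thesis unfolding isCont_def by (rule tendsto_within_subset) simp
qed

text \<open>For \<open>u > 1\<close> the function is continuous. On \<open>(-1, 1)\<close> the connection formula applies, in which only
\<open>Ln(w - 1)\<close> jumps. For \<open>u < -1\<close> the factor \<open>G\<close> is continuous and even, and only \<open>w\<^bsup>-\<nu>-1\<^esup>\<close> jumps.\<close>
lemma legendre_Q_jump:
  fixes u :: real
  assumes \<nu>: "\<nu> > - 3/2" "\<nu> \<noteq> -1" and u: "u \<noteq> 1" "u \<noteq> -1"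
  obtains B where "\<And>s. s \<in> {1, -1} \<Longrightarrow> (legendre_Q \<nu> \<longlongrightarrow> B s) (at (of_real u) within half_plane s)"
    "B (-1) - B 1 = (if u > 1 then 0 else if u > -1 then \<i> * of_real pi * of_real (legendre_P \<nu> u)
      else 2 * \<i> * of_real (sin ((\<nu> + 1) * pi)) * legendre_Q \<nu> (of_real (- u)))"
proof -
  obtain G R where G: "G holomorphic_on - unit_cut" "\<And>w. norm w > 1 \<Longrightarrow> G w = legendre_Q_outer \<nu> w"
    "\<And>w. w \<notin> unit_cut \<Longrightarrow> G (- w) = G w"
    and R: "R holomorphic_on ball 1 2"
    "\<And>w. w \<in> ball 1 2 \<Longrightarrow> w \<notin> unit_cut \<Longrightarrow> w powr of_real (- \<nu> - 1) * G w
      = - 1/2 * eval_at_1 (legendre_P_fps \<nu>) w * Ln (w - 1) + R w"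
    using legendre_Q_even_extension[OF \<nu>] by blast
  note Q = legendre_Q_eq[OF \<nu> G(1,2)]
  have G_cont: "(G \<longlongrightarrow> G (of_real u)) (at (of_real u) within S)" if "\<bar>u\<bar> > 1" for S
    using that by (intro holomorphic_tendsto_within[OF G(1) open_unit_cut_complement])
      (auto simp: of_real_image_iff)
  have Q_near: "\<forall>\<^sub>F w in at (of_real u) within half_plane s. w powr of_real (- \<nu> - 1) * G w = legendre_Q \<nu> w" for s
    unfolding eventually_at_filter
    by (rule always_eventually) (use Q half_plane_off_left_cut in auto)
  consider "u > 1" | "-1 < u" "u < 1" | "u < -1" using u by linarith
  then show thesis
  proof cases
    case 1
    have "(legendre_Q \<nu> \<longlongrightarrow> of_real u powr of_real (- \<nu> - 1) * G (of_real u))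
        (at (of_real u) within half_plane s)" for s
    proof (rule Lim_transform_eventually[OF _ Q_near])
      show "((\<lambda>w. w powr of_real (- \<nu> - 1) * G w) \<longlongrightarrow> of_real u powr of_real (- \<nu> - 1) * G (of_real u))
          (at (of_real u) within half_plane s)"
        using 1 by (intro tendsto_mult G_cont tendsto_powr_complex tendsto_ident_at tendsto_const)
          (auto simp: complex_nonpos_Reals_iff)
    qed
    then show thesis using 1 that[of "\<lambda>_. of_real u powr of_real (- \<nu> - 1) * G (of_real u)"] by simp
  next
    case 2
    have u_ball: "complex_of_real u \<in> ball 1 2"
    proof -
      have "dist (complex_of_real 1) (of_real u) < 2"
        unfolding dist_of_real dist_real_def using 2 by auto
      then show ?thesis by simp
    qed
    define B where "B s = - 1/2 * complex_of_real (legendre_P \<nu> u)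
      * (of_real (ln (1 - u)) + of_real s * \<i> * of_real pi) + R (of_real u)" for s
    have lim: "(legendre_Q \<nu> \<longlongrightarrow> B s) (at (of_real u) within half_plane s)" if s: "s \<in> {1, -1}" for s
    proof (rule Lim_transform_eventually)
      have shift: "filterlim (\<lambda>w. w - 1) (at (of_real (u - 1)) within half_plane s)
          (at (of_real u) within half_plane s)"
      proof (rule filterlim_at_withinI)
        show "((\<lambda>w. w - 1) \<longlongrightarrow> of_real (u - 1)) (at (of_real u) within half_plane s)"
          by (auto intro!: tendsto_eq_intros)
        show "\<forall>\<^sub>F w in at (of_real u) within half_plane s. w - 1 \<in> half_plane s - {of_real (u - 1)}"
          by (auto simp: eventually_at_filter half_plane_def)
      qed
      have L: "((\<lambda>w. Ln (w - 1)) \<longlongrightarrow> of_real (ln (1 - u)) + of_real s * \<i> * of_real pi)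
          (at (of_real u) within half_plane s)"
        using filterlim_compose[OF Ln_half_plane_limit[OF s] shift] 2 by simp
      have P: "(eval_at_1 (legendre_P_fps \<nu>) \<longlongrightarrow> of_real (legendre_P \<nu> u)) (at (of_real u) within half_plane s)"
        using holomorphic_tendsto_within[OF holomorphic_eval_at_1[OF legendre_P_fps_radius[of \<nu>]] open_ball u_ball]
          eval_at_1_legendre_P[OF 2] by simp
      have R': "(R \<longlongrightarrow> R (of_real u)) (at (of_real u) within half_plane s)"
        by (rule holomorphic_tendsto_within[OF R(1) open_ball u_ball])
      show "((\<lambda>w. - 1/2 * eval_at_1 (legendre_P_fps \<nu>) w * Ln (w - 1) + R w) \<longlongrightarrow> B s)
          (at (of_real u) within half_plane s)"
        unfolding B_def by (intro tendsto_intros L P R')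
      have "\<forall>\<^sub>F w in at (of_real u) within half_plane s. w \<in> ball 1 2"
        using u_ball unfolding eventually_at_topological by (intro exI[of _ "ball 1 2"]) simp
      moreover have "\<forall>\<^sub>F w in at (of_real u) within half_plane s. w \<in> half_plane s"
        by (simp add: eventually_at_filter)
      ultimately show "\<forall>\<^sub>F w in at (of_real u) within half_plane s.
          - 1/2 * eval_at_1 (legendre_P_fps \<nu>) w * Ln (w - 1) + R w = legendre_Q \<nu> w"
      proof eventually_elim
        case (elim w)
        have "w \<notin> left_cut" using half_plane_off_left_cut elim by blast
        moreover from this have "w \<notin> unit_cut" using unit_cut_subset_left_cut by blast
        ultimately show ?case using R(2)[OF elim(1)] Q by simp
      qed
    qed
    show thesis
    proof (rule that[OF lim])
      have "B (-1) - B 1 = \<i> * of_real pi * of_real (legendre_P \<nu> u)"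
        by (simp add: B_def algebra_simps)
      then show "B (-1) - B 1 = (if u > 1 then 0 else if u > -1 then \<i> * of_real pi * of_real (legendre_P \<nu> u)
          else 2 * \<i> * of_real (sin ((\<nu> + 1) * pi)) * legendre_Q \<nu> (of_real (- u)))"
        using 2 by simp
    qed
  next
    case 3
    define a where "a = complex_of_real (- \<nu> - 1)"
    have Qu: "legendre_Q \<nu> (of_real (- u)) = of_real (- u) powr a * G (of_real u)"
      using Q[of "of_real (- u)"] G(3)[of "of_real u"] 3
      by (simp add: a_def of_real_image_iff)
    define B where "B s = exp (a * of_real s * \<i> * of_real pi) * legendre_Q \<nu> (of_real (- u))" for s
    have lim: "(legendre_Q \<nu> \<longlongrightarrow> B s) (at (of_real u) within half_plane s)" if s: "s \<in> {1, -1}" for s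
    proof (rule Lim_transform_eventually[OF _ Q_near])
      have "((\<lambda>w. w powr a * G w) \<longlongrightarrow>
          exp (a * of_real s * \<i> * of_real pi) * of_real (- u) powr a * G (of_real u))
          (at (of_real u) within half_plane s)"
        using 3 by (intro tendsto_mult powr_half_plane_limit s G_cont) auto
      then show "((\<lambda>w. w powr of_real (- \<nu> - 1) * G w) \<longlongrightarrow> B s) (at (of_real u) within half_plane s)"
        by (simp only: B_def Qu a_def mult.assoc)
    qed
    show thesis
    proof (rule that[OF lim])
      define y where "y = (\<nu> + 1) * pi"
      have "a * of_real (-1) * \<i> * of_real pi = \<i> * of_real y" "a * of_real 1 * \<i> * of_real pi = - (\<i> * of_real y)"
        by (simp_all add: a_def y_def algebra_simps)
      then have "B (-1) - B 1 = (exp (\<i> * of_real y) - exp (- (\<i> * of_real y))) * legendre_Q \<nu> (of_real (- u))"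
        unfolding B_def by (simp only: left_diff_distrib)
      also have "exp (\<i> * of_real y) - exp (- (\<i> * of_real y)) = 2 * \<i> * sin (complex_of_real y)"
        by (simp add: sin_exp_eq)
      also have "sin (complex_of_real y) = of_real (sin y)" by (rule sin_of_real)
      finally show "B (-1) - B 1 = (if u > 1 then 0 else if u > -1 then \<i> * of_real pi * of_real (legendre_P \<nu> u)
          else 2 * \<i> * of_real (sin ((\<nu> + 1) * pi)) * legendre_Q \<nu> (of_real (- u)))"
        using 3 by (simp add: y_def)
    qed
  qed
qed

section \<open>The kernel\<close>

lemma legendre_Q_even_extension_exists:
  assumes "\<nu> > - 3/2" "\<nu> \<noteq> -1"
  shows "\<exists>G. G holomorphic_on - unit_cut \<and> (\<forall>w. norm w > 1 \<longrightarrow> G w = legendre_Q_outer \<nu> w) \<and>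
    (\<forall>w. w \<notin> unit_cut \<longrightarrow> G (- w) = G w)"
proof -
  obtain G R where "G holomorphic_on - unit_cut" "\<And>w. norm w > 1 \<Longrightarrow> G w = legendre_Q_outer \<nu> w"
    "\<And>w. w \<notin> unit_cut \<Longrightarrow> G (- w) = G w" "R holomorphic_on ball 1 2"
    "\<And>w. w \<in> ball 1 2 \<Longrightarrow> w \<notin> unit_cut \<Longrightarrow> w powr of_real (- \<nu> - 1) * G w
      = - 1/2 * eval_at_1 (legendre_P_fps \<nu>) w * Ln (w - 1) + R w"
    using legendre_Q_even_extension[OF assms] by blast
  then show ?thesis by (intro exI[of _ G]) simp
qed

text \<open>The continuation of \<open>Psi\<close> is \<open>b G\<^bsub>b-1\<^esub>(v) - b G\<^sub>b(v)/v\<close>. Its argument in \<open>Phi\<close> is \<open>sgn(xy) w\<close>, and evenness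
of \<open>G\<^bsub>b-1\<^esub>\<close> and \<open>G\<^sub>b\<close> moves the sign to the front of the second term.\<close>
lemma Phi_eq_legendre_Q:
  fixes x y b :: real and z :: complex
  assumes b: "b > - 1/2" "b \<noteq> 0" and xy: "x \<noteq> 0" "y \<noteq> 0"
  defines "w \<equiv> (of_real x ^ 2 + of_real y ^ 2 - z ^ 2) / of_real (2 * \<bar>x\<bar> * \<bar>y\<bar>)"
  assumes w: "Im w \<noteq> 0"
  shows "of_real (\<bar>x\<bar> powr b * \<bar>y\<bar> powr b) * Phi b x y z
    = of_real b * (legendre_Q (b - 1) w - of_real (sgn (x * y)) * legendre_Q b w)"
proof -
  have \<nu>1: "b - 1 > - 3/2" "b - 1 \<noteq> -1" and \<nu>2: "b > - 3/2" "b \<noteq> -1"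
    using b by auto
  obtain G1 where G1: "G1 holomorphic_on - unit_cut" "\<And>w. norm w > 1 \<Longrightarrow> G1 w = legendre_Q_outer (b - 1) w"
    "\<And>w. w \<notin> unit_cut \<Longrightarrow> G1 (- w) = G1 w"
    using legendre_Q_even_extension_exists[OF \<nu>1] by blast
  obtain G2 where G2: "G2 holomorphic_on - unit_cut" "\<And>w. norm w > 1 \<Longrightarrow> G2 w = legendre_Q_outer b w"
    "\<And>w. w \<notin> unit_cut \<Longrightarrow> G2 (- w) = G2 w"
    using legendre_Q_even_extension_exists[OF \<nu>2] by blast
  define \<sigma> where "\<sigma> = sgn (x * y)"
  have "sgn x = 1 \<or> sgn x = -1" "sgn y = 1 \<or> sgn y = -1"
    using xy by (simp_all add: sgn_if)
  then have \<sigma>: "\<sigma> = 1 \<or> \<sigma> = -1" unfolding \<sigma>_def sgn_mult by (elim disjE) simp_all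
  have xy_eq: "x * y = \<sigma> * (\<bar>x\<bar> * \<bar>y\<bar>)"
    unfolding \<sigma>_def abs_mult[symmetric] by (simp only: sgn_mult_abs)
  define c where "c = \<bar>x\<bar> * \<bar>y\<bar>"
  have c: "c > 0" using xy by (simp add: c_def)
  define \<zeta> where "\<zeta> = (of_real x ^ 2 + of_real y ^ 2 - z ^ 2) / (2 :: complex)"
  have \<zeta>w: "\<zeta> = of_real c * w" using xy by (simp add: \<zeta>_def w_def c_def)
  have arg: "(of_real x ^ 2 + of_real y ^ 2 - z ^ 2) / (2 * of_real x * of_real y) = of_real \<sigma> * w"
  proof -
    have "(of_real x ^ 2 + of_real y ^ 2 - z ^ 2) / (2 * of_real x * of_real y) = \<zeta> / of_real (x * y)"
      by (simp add: \<zeta>_def)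
    also have "\<dots> = of_real c * w / (of_real \<sigma> * of_real c)"
      unfolding xy_eq c_def[symmetric] \<zeta>w by simp
    also have "\<dots> = of_real \<sigma> * w" using \<sigma> c by (elim disjE) simp_all
    finally show ?thesis .
  qed
  have off: "v \<notin> unit_cut" "v \<notin> left_cut" if "Im v \<noteq> 0" for v using that by auto
  have Psi: "Psi b v = of_real b * G1 v - of_real b * (G2 v / v)" if "Im v \<noteq> 0" for v
  proof (rule Psi_eqI)
    show "(\<lambda>v. of_real b * G1 v - of_real b * (G2 v / v)) holomorphic_on - unit_cut"
      by (intro holomorphic_intros G1 G2) (auto simp: of_real_image_iff)
    show "of_real b * G1 v - of_real b * (G2 v / v) = Psi_series b v" if "norm v > 1" for v
      using that by (simp add: Psi_series_eq[OF b] G1(2) G2(2))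
  qed (use off that in blast)
  have w0: "w \<noteq> 0" using w by auto
  have psi: "Psi b (of_real \<sigma> * w) = of_real b * (G1 w - of_real \<sigma> * (G2 w / w))"
    using \<sigma>
  proof
    assume "\<sigma> = 1"
    then show ?thesis using Psi[OF w] by (simp add: algebra_simps)
  next
    assume "\<sigma> = -1"
    then show ?thesis using Psi[of "- w"] w G1(3) G2(3) off[OF w] by (simp add: algebra_simps)
  qed
  have pow: "of_real (\<bar>x\<bar> powr b * \<bar>y\<bar> powr b) * \<zeta> powr (- of_real b) = w powr (- of_real b)"
  proof -
    have "\<zeta> powr (- of_real b) = of_real c powr (- of_real b) * w powr (- of_real b)"
      unfolding \<zeta>w using c by (intro powr_times_real_left) auto
    also have "of_real c powr (- of_real b) = (of_real (c powr (- b)) :: complex)"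
      using c powr_of_real[of c "- b"] by simp
    also have "of_real (\<bar>x\<bar> powr b * \<bar>y\<bar> powr b) * (of_real (c powr (- b)) * w powr (- of_real b))
        = of_real (c powr b * c powr (- b)) * w powr (- of_real b)"
      using xy by (simp add: c_def powr_mult)
    also have "c powr b * c powr (- b) = 1" using c by (simp flip: powr_add)
    finally show ?thesis by simp
  qed
  have Q1: "legendre_Q (b - 1) w = w powr (- of_real b) * G1 w"
    using legendre_Q_eq[OF \<nu>1 G1(1,2) off(2)[OF w]] by simp
  have Q2: "legendre_Q b w = w powr (- of_real b) * (G2 w / w)"
    using legendre_Q_eq[OF \<nu>2 G2(1,2) off(2)[OF w]] w0 by (simp add: powr_diff)
  have "of_real (\<bar>x\<bar> powr b * \<bar>y\<bar> powr b) * Phi b x y z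
      = w powr (- of_real b) * (of_real b * (G1 w - of_real \<sigma> * (G2 w / w)))"
    unfolding Phi_def arg \<zeta>_def[symmetric] psi pow mult.assoc[symmetric] ..
  also have "\<dots> = of_real b * (w powr (- of_real b) * G1 w - of_real \<sigma> * (w powr (- of_real b) * (G2 w / w)))"
    by (simp only: right_diff_distrib mult_ac)
  finally show ?thesis unfolding Q1 Q2 \<sigma>_def .
qed

lemma Phi_0_eq_1:
  fixes x y :: real
  assumes xy: "x \<noteq> 0" "y \<noteq> 0"
    and im: "Im (of_real x ^ 2 + of_real y ^ 2 - z ^ 2 :: complex) \<noteq> 0"
  shows "Phi 0 x y z = 1"
proof -
  let ?n = "of_real x ^ 2 + of_real y ^ 2 - z ^ 2 :: complex"
  have "?n / (2 * of_real x * of_real y) = ?n / of_real (2 * x * y)" by simp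
  then have "Im (?n / (2 * of_real x * of_real y)) = Im ?n / (2 * x * y)"
    by (simp only: Im_divide_of_real)
  then have "Im (?n / (2 * of_real x * of_real y)) \<noteq> 0" using im xy by simp
  then have "?n / (2 * of_real x * of_real y) \<notin> unit_cut" by (auto simp: of_real_image_iff)
  moreover have "?n \<noteq> 0"
  proof
    assume "?n = 0"
    then have "Im ?n = 0" by (simp only: zero_complex.sel)
    then show False using im by contradiction
  qed
  ultimately show ?thesis by (simp add: Phi_def Psi_0)
qed

lemma Im_numerator:
  "Im (of_real x ^ 2 + of_real y ^ 2 - (of_real t + of_real \<tau> * (\<i> * of_real e)) ^ 2) = - 2 * t * (\<tau> * e)"
  by (simp add: power2_eq_square)

text \<open>The imaginary part is \<open>-t \<tau> e / (\<bar>x\<bar>\<bar>y\<bar>)\<close>, so the side of approach is opposite to the sign of \<open>\<tau> t\<close>.\<close>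
lemma argument_approaches_cut:
  fixes x y t \<tau> :: real
  assumes xy: "x \<noteq> 0" "y \<noteq> 0" and t: "t \<noteq> 0" and \<tau>: "\<tau> \<in> {1, -1}"
  shows "filterlim (\<lambda>e. (of_real x ^ 2 + of_real y ^ 2 - (of_real t + of_real \<tau> * (\<i> * of_real e)) ^ 2)
      / of_real (2 * \<bar>x\<bar> * \<bar>y\<bar>))
    (at (of_real ((x\<^sup>2 + y\<^sup>2 - t\<^sup>2) / (2 * \<bar>x\<bar> * \<bar>y\<bar>))) within half_plane (- \<tau> * sgn t)) (at_right 0)"
    (is "filterlim ?w (at ?u within _) _")
proof (rule filterlim_at_withinI)
  define d where "d = 2 * \<bar>x\<bar> * \<bar>y\<bar>"
  have d: "d > 0" using xy by (simp add: d_def)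
  have "((\<lambda>e::real. (of_real x ^ 2 + of_real y ^ 2 - (of_real t + of_real \<tau> * (\<i> * of_real e)) ^ 2) / of_real d)
      \<longlongrightarrow> (of_real x ^ 2 + of_real y ^ 2 - (of_real t + of_real \<tau> * (\<i> * of_real 0)) ^ 2) / (of_real d :: complex)) (at_right 0)"
    using d by (intro tendsto_intros) auto
  then show "(?w \<longlongrightarrow> ?u) (at_right 0)" by (simp add: d_def)
  have "\<forall>\<^sub>F e in at_right (0::real). e > 0" by (simp add: eventually_at_filter)
  then show "\<forall>\<^sub>F e in at_right (0::real). ?w e \<in> half_plane (- \<tau> * sgn t) - {?u}"
  proof eventually_elim
    case (elim e)
    have "Im (?w e) = - 2 * t * (\<tau> * e) / d"
      unfolding d_def[symmetric] Im_divide_of_real Im_numerator ..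
    then have "(- \<tau> * sgn t) * Im (?w e) = (\<tau> * \<tau>) * (sgn t * t) * (2 * e / d)"
      by (simp only:) simp
    moreover have "\<tau> * \<tau> = 1" using \<tau> by auto
    moreover have "sgn t * t > 0" using t by (simp add: sgn_if)
    then have "sgn t * t * (2 * e / d) > 0"
      using elim d by (intro mult_pos_pos[of "sgn t * t"] divide_pos_pos) simp_all
    ultimately have pos: "(- \<tau> * sgn t) * Im (?w e) > 0" by (simp only: mult_1_left)
    then have "Im (?w e) \<noteq> 0" by auto
    then have "?w e \<noteq> ?u" by (metis Im_complex_of_real)
    with pos show ?case by (simp add: half_plane_def)
  qed
qed

theorem theoremC:
  fixes b x y t u :: real
  assumes "b > - 1/2"
    and "x \<noteq> 0" and "y \<noteq> 0"
    and "\<bar>t\<bar> \<noteq> \<bar>\<bar>x\<bar> - \<bar>y\<bar>\<bar>" and "\<bar>t\<bar> \<noteq> \<bar>x\<bar> + \<bar>y\<bar>"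
    and "u = (x\<^sup>2 + y\<^sup>2 - t\<^sup>2) / (2 * \<bar>x\<bar> * \<bar>y\<bar>)"
  shows "(\<exists>l. (Phi_jump b x y t \<longlongrightarrow> l) (at_right 0)) \<and>
    kernel_K b x y t = of_real (sgn t) *
      (if \<bar>t\<bar> < \<bar>\<bar>x\<bar> - \<bar>y\<bar>\<bar> then 0
       else if \<bar>\<bar>x\<bar> - \<bar>y\<bar>\<bar> < \<bar>t\<bar> \<and> \<bar>t\<bar> < \<bar>x\<bar> + \<bar>y\<bar> then
         of_real (b * (1/2 * (- legendre_P (b - 1) u + sgn (x * y) * legendre_P b u)))
       else
         - of_real (sin (b * pi) / pi) *
           (b_legendre_Q b (of_real (- u))
             + of_real (sgn (x * y)) * (of_real b * legendre_Q b (of_real (- u)))))"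
proof (cases "b = 0 \<or> t = 0")
  case True
  have "\<forall>\<^sub>F e in at_right (0::real). 0 = Phi_jump b x y t e"
  proof -
    have "\<forall>\<^sub>F e in at_right (0::real). e > 0" by (simp add: eventually_at_filter)
    then show ?thesis
    proof eventually_elim
      case (elim e)
      show ?case
      proof (cases "t = 0")
        case True
        then show ?thesis by (simp add: Phi_jump_def Phi_def)
      next
        case False
        with True have b: "b = 0" by simp
        have "Im (of_real x ^ 2 + of_real y ^ 2 - (of_real t + \<i> * of_real e) ^ 2) \<noteq> 0"
          "Im (of_real x ^ 2 + of_real y ^ 2 - (of_real t - \<i> * of_real e) ^ 2) \<noteq> 0"
          using Im_numerator[of x y t 1 e] Im_numerator[of x y t "-1" e] False elim by simp_all
        then show ?thesis using assms(2,3) by (simp add: Phi_jump_def b Phi_0_eq_1)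
      qed
    qed
  qed
  then have lim: "(Phi_jump b x y t \<longlongrightarrow> 0) (at_right 0)"
    by (rule Lim_transform_eventually[OF tendsto_const])
  then have "kernel_K b x y t = 0"
    by (simp add: kernel_K_def tendsto_Lim)
  then show ?thesis using lim True by auto
next
  case False
  then have b: "b > - 1/2" "b \<noteq> 0" and t: "t \<noteq> 0" using assms(1) by auto
  define s where "s = sgn t"
  have s: "s \<in> {1, -1}" using t by (auto simp: s_def sgn_if)
  define \<sigma> where "\<sigma> = complex_of_real (sgn (x * y))"
  define c where "c = complex_of_real (\<bar>x\<bar> powr b * \<bar>y\<bar> powr b)"
  have c: "c \<noteq> 0" using assms(2,3) by (simp add: c_def)
  define d where "d = 2 * \<bar>x\<bar> * \<bar>y\<bar>"
  have d: "d > 0" using assms(2,3) by (simp add: d_def)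
  have ud: "u * d = x\<^sup>2 + y\<^sup>2 - t\<^sup>2" using assms(6) d by (simp add: d_def[symmetric])
  have u1: "(u > 1 \<longleftrightarrow> \<bar>t\<bar> < \<bar>\<bar>x\<bar> - \<bar>y\<bar>\<bar>) \<and> (u = 1 \<longleftrightarrow> \<bar>t\<bar> = \<bar>\<bar>x\<bar> - \<bar>y\<bar>\<bar>)"
  proof -
    have "(\<bar>x\<bar> - \<bar>y\<bar>)\<^sup>2 - t\<^sup>2 = (u - 1) * d"
      using ud by (simp add: power2_diff left_diff_distrib d_def)
    then have "0 < (u - 1) * d \<longleftrightarrow> t\<^sup>2 < (\<bar>x\<bar> - \<bar>y\<bar>)\<^sup>2" "(u - 1) * d = 0 \<longleftrightarrow> t\<^sup>2 = (\<bar>x\<bar> - \<bar>y\<bar>)\<^sup>2"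
      by linarith+
    moreover have "0 < (u - 1) * d \<longleftrightarrow> u > 1" "(u - 1) * d = 0 \<longleftrightarrow> u = 1"
      using d by (auto simp: zero_less_mult_iff)
    moreover have "\<bar>t\<bar> < \<bar>(\<bar>x\<bar> - \<bar>y\<bar>)\<bar> \<longleftrightarrow> t\<^sup>2 < (\<bar>x\<bar> - \<bar>y\<bar>)\<^sup>2" "\<bar>t\<bar> = \<bar>(\<bar>x\<bar> - \<bar>y\<bar>)\<bar> \<longleftrightarrow> t\<^sup>2 = (\<bar>x\<bar> - \<bar>y\<bar>)\<^sup>2"
      by (simp_all only: not_le[symmetric] abs_le_square_iff power2_eq_iff abs_eq_iff)
    ultimately show ?thesis by simp
  qed
  have u2: "(u > -1 \<longleftrightarrow> \<bar>t\<bar> < \<bar>x\<bar> + \<bar>y\<bar>) \<and> (u = -1 \<longleftrightarrow> \<bar>t\<bar> = \<bar>x\<bar> + \<bar>y\<bar>)"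
  proof -
    have "(\<bar>x\<bar> + \<bar>y\<bar>)\<^sup>2 - t\<^sup>2 = (u + 1) * d"
      using ud by (simp add: power2_sum distrib_right d_def)
    then have "0 < (u + 1) * d \<longleftrightarrow> t\<^sup>2 < (\<bar>x\<bar> + \<bar>y\<bar>)\<^sup>2" "(u + 1) * d = 0 \<longleftrightarrow> t\<^sup>2 = (\<bar>x\<bar> + \<bar>y\<bar>)\<^sup>2"
      by linarith+
    moreover have "0 < (u + 1) * d \<longleftrightarrow> u > -1" "(u + 1) * d = 0 \<longleftrightarrow> u = -1"
      using d by (auto simp: zero_less_mult_iff)
    moreover have "\<bar>t\<bar> < \<bar>(\<bar>x\<bar> + \<bar>y\<bar>)\<bar> \<longleftrightarrow> t\<^sup>2 < (\<bar>x\<bar> + \<bar>y\<bar>)\<^sup>2" "\<bar>t\<bar> = \<bar>(\<bar>x\<bar> + \<bar>y\<bar>)\<bar> \<longleftrightarrow> t\<^sup>2 = (\<bar>x\<bar> + \<bar>y\<bar>)\<^sup>2"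
      by (simp_all only: not_le[symmetric] abs_le_square_iff power2_eq_iff abs_eq_iff)
    ultimately show ?thesis by simp
  qed
  have u: "u \<noteq> 1" "u \<noteq> -1" using u1 u2 assms(4,5) by auto
  have \<nu>1: "b - 1 > - 3/2" "b - 1 \<noteq> -1" and \<nu>2: "b > - 3/2" "b \<noteq> -1"
    using b by auto
  \<comment> \<open>\<open>J \<nu>\<close> is the value from below minus the value from above, of \<open>Q\<^sub>\<nu>\<close> at \<open>u\<close>.\<close>
  define J where "J \<nu> = (if u > 1 then 0 else if u > -1 then \<i> * of_real pi * of_real (legendre_P \<nu> u)
      else 2 * \<i> * of_real (sin ((\<nu> + 1) * pi)) * legendre_Q \<nu> (of_real (- u)))" for \<nu>
  obtain B1 where B1: "\<And>s. s \<in> {1, -1} \<Longrightarrow> (legendre_Q (b - 1) \<longlongrightarrow> B1 s) (at (of_real u) within half_plane s)"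
    "B1 (-1) - B1 1 = J (b - 1)"
    using legendre_Q_jump[OF \<nu>1 u] unfolding J_def by blast
  obtain B2 where B2: "\<And>s. s \<in> {1, -1} \<Longrightarrow> (legendre_Q b \<longlongrightarrow> B2 s) (at (of_real u) within half_plane s)"
    "B2 (-1) - B2 1 = J b"
    using legendre_Q_jump[OF \<nu>2 u] unfolding J_def by blast
  define L where "L s' = 1 / c * (of_real b * (B1 s' - \<sigma> * B2 s'))" for s'
  have Phi_lim: "((\<lambda>e. Phi b x y (of_real t + of_real \<tau> * (\<i> * of_real e))) \<longlongrightarrow> L (- \<tau> * s)) (at_right 0)"
    if \<tau>: "\<tau> \<in> {1, -1}" for \<tau> :: real
  proof -
    let ?w = "\<lambda>e. (of_real x ^ 2 + of_real y ^ 2 - (of_real t + of_real \<tau> * (\<i> * of_real e)) ^ 2)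
      / complex_of_real (2 * \<bar>x\<bar> * \<bar>y\<bar>)"
    have \<tau>s: "- \<tau> * s \<in> {1, -1}" using \<tau> s by auto
    have w: "filterlim ?w (at (of_real u) within half_plane (- \<tau> * s)) (at_right 0)"
      unfolding assms(6) s_def by (rule argument_approaches_cut[OF assms(2,3) t \<tau>])
    have "((\<lambda>e. 1 / c * (of_real b * (legendre_Q (b - 1) (?w e) - \<sigma> * legendre_Q b (?w e)))) \<longlongrightarrow> L (- \<tau> * s))
        (at_right 0)"
      unfolding L_def
      by (intro tendsto_mult tendsto_diff tendsto_const filterlim_compose[OF B1(1)[OF \<tau>s] w]
          filterlim_compose[OF B2(1)[OF \<tau>s] w])
    moreover have "\<forall>\<^sub>F e in at_right 0. 1 / c * (of_real b * (legendre_Q (b - 1) (?w e) - \<sigma> * legendre_Q b (?w e)))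
        = Phi b x y (of_real t + of_real \<tau> * (\<i> * of_real e))"
    proof -
      have "\<forall>\<^sub>F e in at_right (0::real). e > 0" by (simp add: eventually_at_filter)
      then show ?thesis
      proof eventually_elim
        case (elim e)
        have "Im (?w e) = - 2 * t * (\<tau> * e) / d"
          unfolding d_def[symmetric] Im_divide_of_real Im_numerator ..
        then have "Im (?w e) \<noteq> 0" using \<tau> t elim d by auto
        from Phi_eq_legendre_Q[OF b assms(2,3) this]
        have "c * Phi b x y (of_real t + of_real \<tau> * (\<i> * of_real e))
            = of_real b * (legendre_Q (b - 1) (?w e) - \<sigma> * legendre_Q b (?w e))"
          unfolding c_def \<sigma>_def .
        then show ?case using c by (metis nonzero_mult_div_cancel_left times_divide_eq_left mult_1)
      qed
    qed
    ultimately show ?thesis by (rule Lim_transform_eventually)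
  qed
  have lim: "(Phi_jump b x y t \<longlongrightarrow> L (- s) - L s) (at_right 0)"
    using tendsto_diff[OF Phi_lim[of 1] Phi_lim[of "-1"]]
    by (simp add: Phi_jump_def[abs_def])
  have "L (- s) - L s = 1 / c * (of_real b * (of_real s * (J (b - 1) - \<sigma> * J b)))"
  proof -
    have "L (- s) - L s = 1 / c * (of_real b * ((B1 (- s) - B1 s) - \<sigma> * (B2 (- s) - B2 s)))"
      unfolding L_def right_diff_distrib[symmetric] by (simp only: right_diff_distrib diff_diff_eq2 diff_diff_eq algebra_simps)
    moreover have "B1 (- s) - B1 s = of_real s * J (b - 1)" "B2 (- s) - B2 s = of_real s * J b"
      unfolding B1(2)[symmetric] B2(2)[symmetric] using s by auto
    ultimately show ?thesis by (simp add: right_diff_distrib mult.left_commute)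
  qed
  moreover have "Lim (at_right 0) (Phi_jump b x y t) = L (- s) - L s"
    by (rule tendsto_Lim[OF _ lim]) simp
  moreover have "q * c * (1 / c * r) = q * r" for q r using c by simp
  ultimately have K: "kernel_K b x y t
      = - 1 / (2 * of_real pi * \<i>) * (of_real b * (of_real s * (J (b - 1) - \<sigma> * J b)))"
    unfolding kernel_K_def c_def[symmetric] by (simp only:)
  have pi_i: "- 1 / (2 * of_real pi * \<i>) * (\<i> * of_real pi * q) = - 1/2 * q"
    "- 1 / (2 * of_real pi * \<i>) * (2 * \<i> * q) = - (q / of_real pi)" for q :: complex
    by (simp_all add: divide_simps)
  consider "u > 1" | "-1 < u" "u < 1" | "u < -1" using u by linarith
  then have "kernel_K b x y t = of_real s *
      (if \<bar>t\<bar> < \<bar>\<bar>x\<bar> - \<bar>y\<bar>\<bar> then 0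
       else if \<bar>\<bar>x\<bar> - \<bar>y\<bar>\<bar> < \<bar>t\<bar> \<and> \<bar>t\<bar> < \<bar>x\<bar> + \<bar>y\<bar> then
         of_real (b * (1/2 * (- legendre_P (b - 1) u + sgn (x * y) * legendre_P b u)))
       else
         - of_real (sin (b * pi) / pi) *
           (b_legendre_Q b (of_real (- u)) + \<sigma> * (of_real b * legendre_Q b (of_real (- u)))))"
  proof cases
    case 1
    then show ?thesis unfolding K J_def using u1 by simp
  next
    case 2
    have "of_real b * (of_real s * (J (b - 1) - \<sigma> * J b)) = \<i> * of_real pi *
        (of_real b * (of_real s * (of_real (legendre_P (b - 1) u) - \<sigma> * of_real (legendre_P b u))))"
      unfolding J_def using 2 by (simp add: algebra_simps)
    then have "kernel_K b x y t = - 1/2 *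
        (of_real b * (of_real s * (of_real (legendre_P (b - 1) u) - \<sigma> * of_real (legendre_P b u))))"
      unfolding K by (simp only: pi_i)
    also have "\<dots> = of_real s * of_real (b * (1/2 * (- legendre_P (b - 1) u + sgn (x * y) * legendre_P b u)))"
      unfolding \<sigma>_def by (simp add: algebra_simps)
    finally show ?thesis using 2 u1 u2 assms(4) by auto
  next
    case 3
    have "sin ((b + 1) * pi) = - sin (b * pi)" by (simp add: distrib_right)
    then have "of_real b * (of_real s * (J (b - 1) - \<sigma> * J b)) = 2 * \<i> *
        (of_real b * (of_real s * (of_real (sin (b * pi)) *
          (legendre_Q (b - 1) (of_real (- u)) + \<sigma> * legendre_Q b (of_real (- u))))))"
      unfolding J_def using 3 by (simp add: algebra_simps)
    then have "kernel_K b x y t = - (of_real b * (of_real s * (of_real (sin (b * pi)) *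
          (legendre_Q (b - 1) (of_real (- u)) + \<sigma> * legendre_Q b (of_real (- u))))) / of_real pi)"
      unfolding K by (simp only: pi_i)
    also have "\<dots> = of_real s * (- of_real (sin (b * pi) / pi) *
           (b_legendre_Q b (of_real (- u)) + \<sigma> * (of_real b * legendre_Q b (of_real (- u)))))"
      using b by (simp add: b_legendre_Q_def add_divide_distrib algebra_simps)
    finally show ?thesis using 3 u1 u2 by auto
  qed
  then show ?thesis using lim unfolding s_def \<sigma>_def by blast
qed

end
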